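(* Let $L$ satisfy the standing assumptions listed in the context. Let $x,y\in\mathbb{R}^n$, $t>0$, $u\in\mathbb{R}$, let $\xi\in\Gamma^t_{x,y}$ be a minimizer for $h_L(t,x,y,u)$, let $u_\xi$ be the solution of $\dot u_\xi(s)=L(\xi(s),\dot\xi(s),u_\xi(s))$ on $[0,t]$ with $u_\xi(0)=u$, and let $p(s)=L_v(\xi(s),\dot\xi(s),u_\xi(s))$ for $s\in[0,t]$. Then: (1) For every $s\in(0,t]$, $$p_y(s):=L_v(\xi(s),\dot\xi(s),u_\xi(s))\in D^+_y h_L(s,x,\xi(s),u).$$ Moreover, if $h_L(t,x,\cdot,u)$ is differentiable at $y$, then $D_yh_L(t,x,y,u)=L_v(\xi(t),\dot\xi(t),u_\xi(t))$. (2) One has $$p_x(t):=-e^{\int_0^t L_u(\xi,\dot\xi,u_\xi)\,d\tau}\,L_v(\xi(0),\dot\xi(0),u_\xi(0))\in D^+_xh_L(t,x,y,u).$$ Moreover, if $h_L(t,\cdot,y,u)$ is differentiable at $x$, then $D_xh_L(t,x,y,u)=p_x(t)$. (3) One has $$p_u(t):=e^{\int_0^t L_u(\xi,\dot\xi,u_\xi)\,d\tau}-1\in D^+_uh_L(t,x,y,u).$$ Moreover, if $h_L(t,x,y,\cdot)$ is differentiable at $u$, then $D_uh_L(t,x,y,u)=p_u(t)$. (4) Set $$E(s):=e^{-\int_0^sL_u(\xi,\dot\xi,u_\xi)\,d\tau}\bigl[L_v(\xi(s),\dot\xi(s),u_\xi(s))\cdot\dot\xi(s)-L(\xi(s),\dot\xi(s),u_\xi(s))\bigr],\qquad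 s\in[0,t].$$ Then $-e^{\int_0^tL_u(\xi,\dot\xi,u_\xi)\,ds}\,E(t)\in D^+_th_L(t,x,y,u)$. Moreover, if $h_L(\cdot,x,y,u)$ is differentiable at $t$, then $$D_th_L(t,x,y,u)=-e^{\int_0^tL_u(\xi,\dot\xi,u_\xi)\,ds}\,E(t)=-H(\xi(t),p(t),u_\xi(t)).$$
   Context: Standing assumptions. $L=L(x,v,r):\mathbb{R}^n\times\mathbb{R}^n\times\mathbb{R}\to\mathbb{R}$ is of class $C^2$ and: (L1) $L(x,\cdot,r)$ is strictly convex for all $(x,r)$; (L2) there are superlinear functions $\overline\theta_0,\theta_0:[0,\infty)\to[0,\infty)$ and constants $c_0,c_1\ge0$ with $\overline\theta_0(|v|)+c_1\ge L(x,v,0)\ge\theta_0(|v|)-c_0$ for all $(x,v)$; (L3) there is $K>0$ with $|L_r(x,v,r)|\le K$ for all $(x,v,r)$. The Hamiltonian $H(x,p,r)=\sup_{v\in\mathbb{R}^n}\{\langle p,v\rangle-L(x,v,r)\}$ is of class $C^2$. $L_x,L_v$ and $L_r=L_u$ denote partial derivatives in the first, second and third variable of $L$. Superlinear means $\theta(s)/s\to+\infty$ as $s\to+\infty$. Fundamental solution. $\Gamma^t_{x,y}=\{\xi\in C^2([0,t],\mathbb{R}^n):\xi(0)=x,\ \xi(t)=y\}$. For $\xi\in\Gamma^t_{x,y}$ and $u\in\mathbb{R}$, $u_\xi$ is the unique solution of $\dot u_\xi=L(\xi,\dot\xi,u_\xi)$ on $[0,t]$, $u_\xi(0)=u$. For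 $t>0$, $$h_L(t,x,y,u)=\inf_{\xi\in\Gamma^t_{x,y}}\int_0^tL(\xi,\dot\xi,u_\xi)\,ds=\inf_{\xi\in\Gamma^t_{x,y}}\{u_\xi(t)-u\},$$ and a minimizer is a $\xi\in\Gamma^t_{x,y}$ attaining the infimum. Integrands such as $L_u(\xi,\dot\xi,u_\xi)$ are evaluated at the integration time. Superdifferential. For a real function $f$ on an open subset of a Euclidean space, $D^+f(a)=\{q:\limsup_{b\to a}\frac{f(b)-f(a)-\langle q,b-a\rangle}{|b-a|}\le0\}$. $D^+_y h_L$, $D^+_xh_L$, $D^+_uh_L$, $D^+_th_L$ denote the superdifferentials of $h_L$ with respect to the indicated variable alone (third, second, fourth, first argument, respectively), the other variables being frozen. *)

theory Defs
  imports "HOL-Analysis.Analysis"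
begin

definition C2 :: "('a::real_normed_vector \<Rightarrow> 'b::real_normed_vector) \<Rightarrow> bool" where
  "C2 f \<longleftrightarrow> (\<exists>(f' :: 'a \<Rightarrow> 'a \<Rightarrow>\<^sub>L 'b) (f'' :: 'a \<Rightarrow> 'a \<Rightarrow>\<^sub>L ('a \<Rightarrow>\<^sub>L 'b)).
     (\<forall>z. (f has_derivative blinfun_apply (f' z)) (at z)) \<and>
     (\<forall>z. (f' has_derivative blinfun_apply (f'' z)) (at z)) \<and>
     continuous_on UNIV f'')"

definition grad :: "('a::real_inner \<Rightarrow> real) \<Rightarrow> 'a \<Rightarrow> 'a" where
  "grad f a = (THE D. GDERIV f a :> D)"

definition superdiff :: "('a::euclidean_space \<Rightarrow> real) \<Rightarrow> 'a \<Rightarrow> 'a set" where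
  "superdiff f a =
     {q. Limsup (at a) (\<lambda>b. ereal ((f b - f a - q \<bullet> (b - a)) / norm (b - a))) \<le> 0}"

definition strictly_convex :: "('a::real_vector \<Rightarrow> real) \<Rightarrow> bool" where
  "strictly_convex f \<longleftrightarrow>
     (\<forall>v w c. v \<noteq> w \<longrightarrow> 0 < c \<longrightarrow> c < 1 \<longrightarrow>
        f ((1 - c) *\<^sub>R v + c *\<^sub>R w) < (1 - c) * f v + c * f w)"

text \<open>A superlinear function from the half-line to itself is represented by a function on
  all reals whose values at negative arguments are irrelevant.\<close>

definition superlinear :: "(real \<Rightarrow> real) \<Rightarrow> bool" where
  "superlinear \<theta> \<longleftrightarrow> (\<forall>s\<ge>0. 0 \<le> \<theta> s) \<and> filterlim (\<lambda>s. \<theta> s / s) at_top at_top"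

fun Lv :: "('a::euclidean_space \<times> 'a \<times> real \<Rightarrow> real) \<Rightarrow> 'a \<times> 'a \<times> real \<Rightarrow> 'a" where
  "Lv L (x, v, r) = grad (\<lambda>w. L (x, w, r)) v"

fun Lu :: "('a::euclidean_space \<times> 'a \<times> real \<Rightarrow> real) \<Rightarrow> 'a \<times> 'a \<times> real \<Rightarrow> real" where
  "Lu L (x, v, r) = deriv (\<lambda>q. L (x, v, q)) r"

fun Ham :: "('a::euclidean_space \<times> 'a \<times> real \<Rightarrow> real) \<Rightarrow> 'a \<times> 'a \<times> real \<Rightarrow> real" where
  "Ham L (x, p, r) = (SUP v. p \<bullet> v - L (x, v, r))"

text \<open>Curves on \<open>[0, t]\<close> are functions on all reals of which only the restriction to
  \<open>{0..t}\<close> matters; derivatives are taken within \<open>{0..t}\<close>, hence are one-sided at the endpoints.\<close>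

definition velocity :: "real \<Rightarrow> (real \<Rightarrow> 'a::real_normed_vector) \<Rightarrow> real \<Rightarrow> 'a" where
  "velocity t \<xi> s = vector_derivative \<xi> (at s within {0..t})"

definition C2_curve :: "real \<Rightarrow> (real \<Rightarrow> 'a::real_normed_vector) \<Rightarrow> bool" where
  "C2_curve t \<xi> \<longleftrightarrow> (\<exists>\<xi>' \<xi>''.
     (\<forall>s\<in>{0..t}. (\<xi> has_vector_derivative \<xi>' s) (at s within {0..t})) \<and>
     (\<forall>s\<in>{0..t}. (\<xi>' has_vector_derivative \<xi>'' s) (at s within {0..t})) \<and>
     continuous_on {0..t} \<xi>'')"

definition curves :: "real \<Rightarrow> 'a::real_normed_vector \<Rightarrow> 'a \<Rightarrow> (real \<Rightarrow> 'a) set" where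
  "curves t x y = {\<xi>. C2_curve t \<xi> \<and> \<xi> 0 = x \<and> \<xi> t = y}"

definition lift ::
    "real \<Rightarrow> (real \<Rightarrow> 'a::real_normed_vector) \<Rightarrow> (real \<Rightarrow> real) \<Rightarrow> real \<Rightarrow> 'a \<times> 'a \<times> real" where
  "lift t \<xi> w s = (\<xi> s, velocity t \<xi> s, w s)"

definition is_char_sol ::
    "('a::euclidean_space \<times> 'a \<times> real \<Rightarrow> real) \<Rightarrow> real \<Rightarrow> (real \<Rightarrow> 'a) \<Rightarrow> real \<Rightarrow> (real \<Rightarrow> real) \<Rightarrow> bool" where
  "is_char_sol L t \<xi> u w \<longleftrightarrow>
     w 0 = u \<and>
     (\<forall>s\<in>{0..t}. (w has_real_derivative L (lift t \<xi> w s)) (at s within {0..t}))"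

text \<open>The solution is unique on \<open>{0..t}\<close> only, so \<open>SOME\<close> rather than \<open>THE\<close>; all uses
  below depend only on the values on \<open>{0..t}\<close>.\<close>

definition char_sol ::
    "('a::euclidean_space \<times> 'a \<times> real \<Rightarrow> real) \<Rightarrow> real \<Rightarrow> (real \<Rightarrow> 'a) \<Rightarrow> real \<Rightarrow> real \<Rightarrow> real" where
  "char_sol L t \<xi> u = (SOME w. is_char_sol L t \<xi> u w)"

definition action ::
    "('a::euclidean_space \<times> 'a \<times> real \<Rightarrow> real) \<Rightarrow> real \<Rightarrow> (real \<Rightarrow> 'a) \<Rightarrow> real \<Rightarrow> real" where
  "action L t \<xi> u = integral {0..t} (\<lambda>s. L (lift t \<xi> (char_sol L t \<xi> u) s))"

text \<open>The infimum is one of reals; for \<open>t > 0\<close> the standing assumptions on \<open>L\<close> make the set of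
  actions nonempty and bounded below (likewise for the supremum in \<open>Ham\<close>). For \<open>t \<le> 0\<close> the
  value has no meaning.\<close>

definition fund_sol ::
    "('a::euclidean_space \<times> 'a \<times> real \<Rightarrow> real) \<Rightarrow> real \<Rightarrow> 'a \<Rightarrow> 'a \<Rightarrow> real \<Rightarrow> real" where
  "fund_sol L t x y u = (INF \<xi>\<in>curves t x y. action L t \<xi> u)"

definition minimizer ::
    "('a::euclidean_space \<times> 'a \<times> real \<Rightarrow> real) \<Rightarrow> real \<Rightarrow> 'a \<Rightarrow> 'a \<Rightarrow> real \<Rightarrow> (real \<Rightarrow> 'a) \<Rightarrow> bool" where
  "minimizer L t x y u \<xi> \<longleftrightarrow> \<xi> \<in> curves t x y \<and> action L t \<xi> u = fund_sol L t x y u"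

definition int_Lu ::
    "('a::euclidean_space \<times> 'a \<times> real \<Rightarrow> real) \<Rightarrow> real \<Rightarrow> (real \<Rightarrow> 'a) \<Rightarrow> (real \<Rightarrow> real) \<Rightarrow> real \<Rightarrow> real" where
  "int_Lu L t \<xi> w s = integral {0..s} (\<lambda>\<tau>. Lu L (lift t \<xi> w \<tau>))"

definition energy ::
    "('a::euclidean_space \<times> 'a \<times> real \<Rightarrow> real) \<Rightarrow> real \<Rightarrow> (real \<Rightarrow> 'a) \<Rightarrow> (real \<Rightarrow> real) \<Rightarrow> real \<Rightarrow> real" where
  "energy L t \<xi> w s =
     exp (- int_Lu L t \<xi> w s) *
     (Lv L (lift t \<xi> w s) \<bullet> velocity t \<xi> s - L (lift t \<xi> w s))"

end

theory Submission
  imports Defs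
begin

text \<open>Let \<open>q\<close> be the value of \<open>L\<^sub>v\<close> along the minimizer at an endpoint. Perturb the minimizer
  by \<open>\<phi> e\<close>, where \<open>\<phi>\<close> is a \<open>C\<^sup>2\<close> cut-off concentrated on an interval of length \<open>\<delta>\<close> at that
  endpoint. To first order in \<open>e\<close> the final value of the characteristic solution changes by
  \<open>q \<bullet> e\<close> (at the initial endpoint \<open>- J q \<bullet> e\<close>, with \<open>J\<close> the solution of the linearized
  characteristic equation) up to an error that vanishes as \<open>\<delta> \<rightarrow> 0\<close>. Since the
  superdifferential is closed, this yields (1) and (2) without the Euler--Lagrange equation, hence
  without regularity theory. Perturbing the arrival time together with the endpoint gives (4), and
  perturbing the initial value gives (3). Part (1) for \<open>s < t\<close> uses in addition that restrictions
  of minimizers are minimizers.\<close>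

section \<open>Real-variable tools\<close>

text \<open>The superdifferentials require only upper bounds on \<open>fund_sol\<close>, and any
  admissible competitor gives one; minimality supplies the value at the base point. A variation
  spread over the whole interval would change the final value by an integral of position and
  velocity terms that collapses to a boundary term only after an integration by parts, that is,
  through the Euler--Lagrange (Herglotz) equation. On a window of width \<delta> the position term
  integrates to O(\<delta>), while \<open>Lv L\<close> differs from its endpoint value only by its
  modulus of continuity. The order of choice is therefore: tolerance, then \<delta>, then the radius
  of admissible \<open>e\<close>.

  Competitors must be of class C^2. This rules out corners and piecewise linear cut-offs; cut-offs
  are cubes of positive parts, and joined curves must agree to second order. As the Lagrangian
  depends on the unknown itself, costs of two curves cannot be compared under the integral sign;
  competitors are estimated by supersolutions of the characteristic equation, with the Lipschitz
  constant \<open>K\<close> of (L3).\<close>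

lemma DERIV_max_0_power:
  fixes x :: real
  assumes "2 \<le> n"
  shows "((\<lambda>x. max 0 x ^ n) has_real_derivative n * max 0 x ^ (n - 1)) (at x)"
proof -
  have "((\<lambda>x. if x \<in> {..0} then 0 else x ^ n) has_vector_derivative
      (if x \<in> {..0} then 0 else n * x ^ (n - 1))) (at x within UNIV)"
    by (rule has_vector_derivative_If_within_closures[where T = "{0..}"])
      (use assms in \<open>auto simp: power_0_left has_real_derivative_iff_has_vector_derivative[symmetric]
         intro!: derivative_eq_intros\<close>)
  also have "(\<lambda>x::real. if x \<in> {..0} then 0 else x ^ n) = (\<lambda>x. max 0 x ^ n)"
    using assms by (auto simp: max_def power_0_left)
  also have "(if x \<in> {..0} then 0 else n * x ^ (n - 1)) = n * max 0 x ^ (n - 1)"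
    using assms by (auto simp: max_def power_0_left)
  finally show ?thesis
    by (simp add: has_real_derivative_iff_has_vector_derivative)
qed

lemma DERIV_max_0_affine_power:
  fixes \<alpha> \<beta> :: real
  assumes "2 \<le> n"
  shows "((\<lambda>s. max 0 (\<alpha> + \<beta> * s) ^ n) has_real_derivative n * \<beta> * max 0 (\<alpha> + \<beta> * s) ^ (n - 1))
    (at s within S)"
proof -
  have "((\<lambda>s. \<alpha> + \<beta> * s) has_real_derivative \<beta>) (at s within S)"
    by (auto intro!: derivative_eq_intros)
  from DERIV_chain2[OF DERIV_max_0_power[OF assms] this] show ?thesis by (simp add: mult_ac)
qed

lemma bounded_on_Icc:
  fixes f :: "real \<Rightarrow> 'b::real_normed_vector"
  assumes "continuous_on {a..b} f"
  obtains B where "0 < B" "\<And>s. s \<in> {a..b} \<Longrightarrow> norm (f s) \<le> B"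
proof -
  have "bounded (f ` {a..b})"
    using assms by (intro compact_imp_bounded compact_continuous_image) auto
  then obtain B where "\<forall>x\<in>f ` {a..b}. norm x \<le> B" by (auto simp: bounded_iff)
  then show thesis by (intro that[of "\<bar>B\<bar> + 1"]) (auto intro: order_trans[of _ B])
qed

section \<open>Scalar differential equations: comparison and global existence\<close>

lemma DERIV_within_Icc_antimono:
  fixes f :: "real \<Rightarrow> real"
  assumes "a \<le> b"
    and f': "\<And>s. s \<in> {a..b} \<Longrightarrow> (f has_real_derivative f' s) (at s within {a..b})"
    and "\<And>s. s \<in> {a..b} \<Longrightarrow> f' s \<le> 0"
  shows "f b \<le> f a"
proof (rule DERIV_nonpos_imp_decreasing_open[OF \<open>a \<le> b\<close>])
  show "\<exists>y. DERIV f x :> y \<and> y \<le> 0" if "a < x" "x < b" for x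
    using that f'[of x] assms(3)[of x] by (auto simp: at_within_Icc_at)
  show "continuous_on {a..b} f"
    using f' by (rule DERIV_continuous_on)
qed

text \<open>The positive part of \<open>v - w\<close> is controlled through the \<open>C\<^sup>1\<close> function
  \<open>max 0 (v - w)\<^sup>2\<close>, weighted so as to be nonincreasing.\<close>

lemma ode_comparison:
  fixes v w :: "real \<Rightarrow> real"
  assumes v: "\<And>s. s \<in> {a..b} \<Longrightarrow> (v has_real_derivative v' s) (at s within {a..b})"
    and w: "\<And>s. s \<in> {a..b} \<Longrightarrow> (w has_real_derivative w' s) (at s within {a..b})"
    and le: "\<And>s. s \<in> {a..b} \<Longrightarrow> w s < v s \<Longrightarrow> v' s - w' s \<le> K * (v s - w s)"
    and "v a \<le> w a" and s: "s \<in> {a..b}"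
  shows "v s \<le> w s"
proof -
  define m where "m = (\<lambda>r. max 0 (v r - w r) ^ 2 * exp (- 2 * K * r))"
  define m' where "m' = (\<lambda>r. (2 * max 0 (v r - w r) * (v' r - w' r)
      - 2 * K * max 0 (v r - w r) ^ 2) * exp (- 2 * K * r))"
  have "m s \<le> m a"
  proof (rule DERIV_within_Icc_antimono[where f = m and f' = m'])
    show "a \<le> s" using s by simp
    fix r assume "r \<in> {a..s}"
    then have r: "r \<in> {a..b}" using s by auto
    have "(m has_real_derivative m' r) (at r within {a..b})"
      unfolding m_def m'_def
      by (rule derivative_eq_intros DERIV_chain2[OF DERIV_max_0_power] v w r refl order.refl)+
        (simp add: algebra_simps)
    then show "(m has_real_derivative m' r) (at r within {a..s})"
      by (rule DERIV_subset) (use s in auto)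
    show "m' r \<le> 0"
    proof (cases "w r < v r")
      case True
      then have "2 * (v r - w r) * (v' r - w' r) \<le> 2 * (v r - w r) * (K * (v r - w r))"
        using le[OF r True] by (intro mult_left_mono) auto
      then show ?thesis
        using True unfolding m'_def
        by (intro mult_nonpos_nonneg) (auto simp: power2_eq_square mult_ac)
    qed (auto simp: m'_def max_def)
  qed
  also have "m a = 0" using assms by (simp add: m_def max_def)
  finally have "max 0 (v s - w s) ^ 2 \<le> 0"
    by (simp add: m_def mult_le_0_iff not_le[symmetric])
  then show ?thesis by (auto simp: max_def split: if_splits)
qed

text \<open>The bound is the solution \<open>v\<close> of \<open>v' = K * v - c\<close> with
  \<open>v 0 = - \<bar>w 0\<bar>\<close>. It stays nonpositive, so wherever \<open>w < v\<close> the
  absolute value resolves to \<open>- w\<close> and the hypothesis becomes linear.\<close>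

lemma ode_ge_exp:
  fixes w :: "real \<Rightarrow> real"
  assumes w: "\<And>s. s \<in> {0..b} \<Longrightarrow> (w has_real_derivative w' s) (at s within {0..b})"
    and ge: "\<And>s. s \<in> {0..b} \<Longrightarrow> - c - K * \<bar>w s\<bar> \<le> w' s"
    and "0 < K" "0 \<le> c" "s \<in> {0..b}"
  shows "c / K - (\<bar>w 0\<bar> + c / K) * exp (K * s) \<le> w s"
proof -
  define M where "M = \<bar>w 0\<bar> + c / K"
  define v where "v = (\<lambda>s. c / K - M * exp (K * s))"
  have M: "c / K \<le> M" "0 \<le> M" "c / K \<ge> 0" using assms by (auto simp: M_def)
  have "v s \<le> w s"
  proof (rule ode_comparison[where v = v and w = w and w' = w' and v' = "\<lambda>s. - M * K * exp (K * s)" and a = 0 and b = b and K = K])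
    show "(v has_real_derivative - M * K * exp (K * s)) (at s within {0..b})" for s
      unfolding v_def by (auto intro!: derivative_eq_intros)
    show "v 0 \<le> w 0" by (simp add: v_def M_def)
    fix s assume s: "s \<in> {0..b}" and less: "w s < v s"
    have "M * 1 \<le> M * exp (K * s)"
      using M s \<open>0 < K\<close> by (intro mult_left_mono) auto
    then have "v s \<le> 0" using M by (simp add: v_def)
    then have "\<bar>w s\<bar> = - w s" using less by auto
    then have "- c + K * w s \<le> w' s" using ge[OF s] by simp
    moreover have "K * v s = c - M * K * exp (K * s)"
      using \<open>0 < K\<close> by (simp add: v_def field_simps)
    ultimately show "- M * K * exp (K * s) - w' s \<le> K * (v s - w s)"
      by (simp add: algebra_simps)
  qed (use assms in auto)
  then show ?thesis by (simp add: v_def M_def)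
qed

text \<open>In the norm weighted by \<open>exp (- 2 K s)\<close> the Picard operator is a contraction on the whole
  interval; functions on \<open>{0..b}\<close> are extended to the line by composition with the clamp \<open>c\<close>.\<close>

lemma picard_global:
  fixes G :: "real \<Rightarrow> real \<Rightarrow> real"
  assumes "0 \<le> b" "0 < K"
    and cont: "continuous_on ({0..b} \<times> UNIV) (\<lambda>(s, w). G s w)"
    and lip: "\<And>s w w'. s \<in> {0..b} \<Longrightarrow> \<bar>G s w - G s w'\<bar> \<le> K * \<bar>w - w'\<bar>"
  obtains w where "w 0 = u" "\<And>s. s \<in> {0..b} \<Longrightarrow> (w has_real_derivative G s (w s)) (at s within {0..b})"
proof -
  define c where "c = (\<lambda>s::real. max 0 (min s b))"
  have c: "c s \<in> {0..b}" for s using \<open>0 \<le> b\<close> by (auto simp: c_def)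
  have cid: "c s = s" if "s \<in> {0..b}" for s using that by (auto simp: c_def)
  have ccont: "continuous_on UNIV c" unfolding c_def by (intro continuous_intros)
  \<comment> \<open>The unknown \<open>f\<close> stands for \<open>exp (- 2 * K * s) * w s\<close>,
    so that the plain supremum distance of bounded continuous functions is the weighted distance of
    the solutions.\<close>
  define I where "I = (\<lambda>f s. integral {0..s} (\<lambda>\<tau>. G \<tau> (exp (2 * K * \<tau>) * apply_bcontfun f \<tau>)))"
  define F where "F = (\<lambda>f s. exp (- 2 * K * c s) * (u + I f (c s)))"
  have Gc: "continuous_on {0..b} (\<lambda>\<tau>. G \<tau> (exp (2 * K * \<tau>) * apply_bcontfun f \<tau>))"
    for f :: "real \<Rightarrow>\<^sub>C real"
  proof -
    have "continuous_on {0..b} (\<lambda>\<tau>. (\<tau>, exp (2 * K * \<tau>) * apply_bcontfun f \<tau>))"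
      by (intro continuous_intros) auto
    from continuous_on_compose2[OF cont this] show ?thesis by auto
  qed
  have I': "(I f has_real_derivative G s (exp (2 * K * s) * apply_bcontfun f s)) (at s within {0..b})"
    if "s \<in> {0..b}" for f s
    unfolding I_def by (rule integral_has_real_derivative[OF Gc that])
  have Ic: "continuous_on {0..b} (I f)" for f
    by (rule DERIV_continuous_on, rule I')
  have Fc: "continuous_on UNIV (F f)" for f
    unfolding F_def
    by (intro continuous_intros ccont continuous_on_compose2[OF Ic ccont]) (use c in auto)
  have Fb: "F f \<in> bcontfun" for f
  proof -
    have "range (F f) = F f ` {0..b}"
    proof (safe)
      fix s show "F f s \<in> F f ` {0..b}"
        using c[of s] by (intro image_eqI[of _ _ "c s"]) (auto simp: F_def cid)
    qed auto
    moreover have "compact (F f ` {0..b})"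
      by (intro compact_continuous_image continuous_on_subset[OF Fc]) auto
    ultimately show ?thesis using Fc by (auto simp: bcontfun_def compact_imp_bounded)
  qed
  define \<Phi> where "\<Phi> = (\<lambda>f. Bcontfun (F f))"
  have \<Phi>: "apply_bcontfun (\<Phi> f) = F f" for f
    unfolding \<Phi>_def by (rule Bcontfun_inverse[OF Fb])
  have "dist (\<Phi> f) (\<Phi> g) \<le> 1 / 2 * dist f g" for f g
  proof (rule dist_bound)
    fix s :: real
    define d where "d = dist f g"
    have d: "\<bar>apply_bcontfun f \<tau> - apply_bcontfun g \<tau>\<bar> \<le> d" "0 \<le> d" for \<tau>
      using dist_bounded[of f \<tau> g] by (simp_all add: d_def dist_real_def)
    have H: "I h (c s) = integral {0..c s} (\<lambda>\<tau>. G \<tau> (exp (2 * K * \<tau>) * apply_bcontfun h \<tau>))"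
      "(\<lambda>\<tau>. G \<tau> (exp (2 * K * \<tau>) * apply_bcontfun h \<tau>)) integrable_on {0..c s}" for h
      using c[of s] by (auto simp: I_def intro!: integrable_continuous_real continuous_on_subset[OF Gc])
    \<comment> \<open>Integrating \<open>K\<close> against the exponent \<open>2 * K\<close> yields
      \<open>K / (2 * K)\<close>, the contraction constant \<open>1 / 2\<close>.\<close>
    have P: "((\<lambda>\<tau>. K * d * exp (2 * K * \<tau>)) has_integral
        (d / 2 * exp (2 * K * c s) - d / 2 * exp (2 * K * 0))) {0..c s}"
      by (rule fundamental_theorem_of_calculus)
        (use c[of s] in \<open>auto simp: has_real_derivative_iff_has_vector_derivative[symmetric]
            intro!: derivative_eq_intros\<close>)
    have "\<bar>I f (c s) - I g (c s)\<bar> = norm (integral {0..c s} (\<lambda>\<tau>. G \<tau> (exp (2 * K * \<tau>) * apply_bcontfun f \<tau>)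
         - G \<tau> (exp (2 * K * \<tau>) * apply_bcontfun g \<tau>)))"
      by (subst integral_diff) (auto simp: H)
    also have "\<dots> \<le> integral {0..c s} (\<lambda>\<tau>. K * d * exp (2 * K * \<tau>))"
    proof (rule integral_norm_bound_integral)
      fix \<tau> assume "\<tau> \<in> {0..c s}"
      then have "\<tau> \<in> {0..b}" using c[of s] by auto
      then have "\<bar>G \<tau> (exp (2 * K * \<tau>) * apply_bcontfun f \<tau>) - G \<tau> (exp (2 * K * \<tau>) * apply_bcontfun g \<tau>)\<bar>
        \<le> K * (exp (2 * K * \<tau>) * \<bar>apply_bcontfun f \<tau> - apply_bcontfun g \<tau>\<bar>)"
        using lip[of \<tau> "exp (2 * K * \<tau>) * apply_bcontfun f \<tau>" "exp (2 * K * \<tau>) * apply_bcontfun g \<tau>"]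
        by (simp add: abs_mult flip: right_diff_distrib)
      also have "\<dots> \<le> K * (exp (2 * K * \<tau>) * d)"
        using d \<open>0 < K\<close> by (intro mult_left_mono) auto
      finally show "norm (G \<tau> (exp (2 * K * \<tau>) * apply_bcontfun f \<tau>) - G \<tau> (exp (2 * K * \<tau>) * apply_bcontfun g \<tau>))
        \<le> K * d * exp (2 * K * \<tau>)" by (simp add: mult_ac)
    qed (use H P in \<open>auto intro: integrable_diff\<close>)
    also have "\<dots> = d / 2 * exp (2 * K * c s) - d / 2" using integral_unique[OF P] by simp
    also have "\<dots> \<le> d / 2 * exp (2 * K * c s)" using d by simp
    finally have "exp (- 2 * K * c s) * \<bar>I f (c s) - I g (c s)\<bar>
        \<le> exp (- 2 * K * c s) * (d / 2 * exp (2 * K * c s))"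
      by (intro mult_left_mono) auto
    also have "\<dots> = d / 2" by (simp add: exp_minus)
    finally show "dist (apply_bcontfun (\<Phi> f) s) (apply_bcontfun (\<Phi> g) s) \<le> 1 / 2 * dist f g"
      by (simp add: \<Phi> F_def dist_real_def d_def abs_mult flip: right_diff_distrib)
  qed
  then obtain f where f: "\<Phi> f = f"
    using banach_fix_type[of "1/2" \<Phi>] by auto
  define w where "w = (\<lambda>s. u + I f s)"
  have eq: "apply_bcontfun f s = exp (- 2 * K * s) * w s" if "s \<in> {0..b}" for s
    using f \<Phi>[of f] cid[OF that] by (simp add: F_def w_def)
  show thesis
  proof
    show "w 0 = u" by (simp add: w_def I_def)
    show "(w has_real_derivative G s (w s)) (at s within {0..b})" if "s \<in> {0..b}" for s
    proof -
      have "exp (2 * K * s) * apply_bcontfun f s = w s"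
        by (simp add: eq[OF that] exp_minus)
      then show ?thesis
        using I'[OF that, of f] unfolding w_def by (auto intro!: derivative_eq_intros)
    qed
  qed
qed

section \<open>Curves of class \<open>C\<^sup>2\<close>\<close>

text \<open>Both derivatives are arguments instead of being quantified away: 2-jets can then be
  compared at a junction, and \<open>g'\<close> can stand for \<open>velocity\<close>, whose
  definition refers to the length of the interval.\<close>

definition C2_on ::
    "real set \<Rightarrow> (real \<Rightarrow> 'a::real_normed_vector) \<Rightarrow> (real \<Rightarrow> 'a) \<Rightarrow> (real \<Rightarrow> 'a) \<Rightarrow> bool" where
  "C2_on S g g' g'' \<longleftrightarrow>
     (\<forall>s\<in>S. (g has_vector_derivative g' s) (at s within S)) \<and>
     (\<forall>s\<in>S. (g' has_vector_derivative g'' s) (at s within S)) \<and>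
     continuous_on S g''"

lemma C2_curve_iff_C2_on: "C2_curve t \<xi> \<longleftrightarrow> (\<exists>\<xi>' \<xi>''. C2_on {0..t} \<xi> \<xi>' \<xi>'')"
  by (simp add: C2_curve_def C2_on_def)

lemma C2_on_subset: "C2_on T g g' g'' \<Longrightarrow> S \<subseteq> T \<Longrightarrow> C2_on S g g' g''"
  unfolding C2_on_def
  by (meson continuous_on_subset has_vector_derivative_within_subset subsetD)

lemma C2_on_imp_continuous_on:
  assumes "C2_on S g g' g''"
  shows "continuous_on S g" "continuous_on S g'"
  using assms by (auto simp: C2_on_def continuous_on_eq_continuous_within
      intro: has_vector_derivative_continuous)

text \<open>As both sets are closed, derivatives within \<open>S\<close> and within \<open>T\<close>
  that agree on \<open>S \<inter> T\<close> combine into a derivative within the union. Agreement of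
  the second derivatives keeps the last component continuous.\<close>

lemma C2_on_glue:
  assumes f: "C2_on S f f' f''" and h: "C2_on T h h' h''" and "closed S" "closed T"
    and eq: "\<And>s. s \<in> S \<Longrightarrow> s \<in> T \<Longrightarrow> f s = h s \<and> f' s = h' s \<and> f'' s = h'' s"
  shows "C2_on (S \<union> T) (\<lambda>s. if s \<in> S then f s else h s)
     (\<lambda>s. if s \<in> S then f' s else h' s) (\<lambda>s. if s \<in> S then f'' s else h'' s)"
proof -
  have cl: "closure S = S" "closure T = T" "S \<union> S \<inter> T = S" "T \<union> S \<inter> T = T"
    using assms by auto
  show ?thesis
    unfolding C2_on_def
    by (intro conjI ballI has_vector_derivative_If_within_closures continuous_on_cases)
      (use assms in \<open>auto simp: cl C2_on_def\<close>)
qed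

lemma C2_on_add:
  "C2_on S f f' f'' \<Longrightarrow> C2_on S h h' h'' \<Longrightarrow>
    C2_on S (\<lambda>s. f s + h s) (\<lambda>s. f' s + h' s) (\<lambda>s. f'' s + h'' s)"
  by (auto simp: C2_on_def intro!: derivative_intros continuous_intros)

lemma C2_on_scaleR:
  fixes f :: "real \<Rightarrow> real"
  assumes f: "C2_on S f f' f''" and h: "C2_on S h h' h''"
  shows "C2_on S (\<lambda>s. f s *\<^sub>R h s) (\<lambda>s. f s *\<^sub>R h' s + f' s *\<^sub>R h s)
    (\<lambda>s. f s *\<^sub>R h'' s + 2 *\<^sub>R f' s *\<^sub>R h' s + f'' s *\<^sub>R h s)"
proof -
  have D: "(p has_real_derivative p' s) (at s within S)"
    if "(p has_vector_derivative p' s) (at s within S)" for p p' :: "real \<Rightarrow> real" and s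
    using that by (simp add: has_real_derivative_iff_has_vector_derivative)
  show ?thesis
    unfolding C2_on_def
  proof (intro conjI ballI)
    fix s assume "s \<in> S"
    then have fs: "(f has_real_derivative f' s) (at s within S)"
      "(f' has_real_derivative f'' s) (at s within S)"
      and hs: "(h has_vector_derivative h' s) (at s within S)"
      "(h' has_vector_derivative h'' s) (at s within S)"
      using f h D by (auto simp: C2_on_def)
    show "((\<lambda>s. f s *\<^sub>R h s) has_vector_derivative (f s *\<^sub>R h' s + f' s *\<^sub>R h s)) (at s within S)"
      by (rule has_vector_derivative_scaleR[OF fs(1) hs(1)])
    show "((\<lambda>s. f s *\<^sub>R h' s + f' s *\<^sub>R h s) has_vector_derivative
        f s *\<^sub>R h'' s + 2 *\<^sub>R f' s *\<^sub>R h' s + f'' s *\<^sub>R h s) (at s within S)"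
      using has_vector_derivative_add[OF has_vector_derivative_scaleR[OF fs(1) hs(2)]
        has_vector_derivative_scaleR[OF fs(2) hs(1)]]
      by (simp add: scaleR_2 scaleR_add_left add_ac flip: scaleR_scaleR)
  next
    show "continuous_on S (\<lambda>s. f s *\<^sub>R h'' s + 2 *\<^sub>R f' s *\<^sub>R h' s + f'' s *\<^sub>R h s)"
      using f h C2_on_imp_continuous_on[OF f] C2_on_imp_continuous_on[OF h]
      by (auto simp: C2_on_def intro!: continuous_intros)
  qed
qed

text \<open>The polynomial with 2-jet \<open>(p, q, r)\<close> at \<open>c\<close>; it serves both
  to prolong curves and to build the corner correction.\<close>

lemma C2_on_quadratic:
  "C2_on S (\<lambda>s. p + (s - c) *\<^sub>R q + ((s - c)\<^sup>2 / 2) *\<^sub>R r) (\<lambda>s. q + (s - c) *\<^sub>R r) (\<lambda>s. r)"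
  unfolding C2_on_def
  by (auto intro!: derivative_eq_intros simp: has_vector_derivative_def scaleR_add_right)

lemma C2_on_const: "C2_on S (\<lambda>s. p) (\<lambda>s. 0) (\<lambda>s. 0)"
  by (simp add: C2_on_def)

text \<open>Three is the least power of a positive part that is of class C^2; the second derivative
  of the square jumps.\<close>

lemma C2_on_cubic_cutoff:
  "C2_on S (\<lambda>s. max 0 (\<alpha> + \<beta> * s) ^ 3) (\<lambda>s. 3 * \<beta> * max 0 (\<alpha> + \<beta> * s) ^ 2)
     (\<lambda>s. 6 * \<beta>\<^sup>2 * max 0 (\<alpha> + \<beta> * s))"
  unfolding C2_on_def has_real_derivative_iff_has_vector_derivative[symmetric]
proof (intro conjI ballI continuous_intros)
  fix s
  show "((\<lambda>s. max 0 (\<alpha> + \<beta> * s) ^ 3) has_real_derivative 3 * \<beta> * max 0 (\<alpha> + \<beta> * s) ^ 2) (at s within S)"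
    using DERIV_max_0_affine_power[of 3 \<alpha> \<beta> s S] by simp
  show "((\<lambda>s. 3 * \<beta> * max 0 (\<alpha> + \<beta> * s) ^ 2) has_real_derivative 6 * \<beta>\<^sup>2 * max 0 (\<alpha> + \<beta> * s)) (at s within S)"
    using DERIV_cmult[OF DERIV_max_0_affine_power[of 2 \<alpha> \<beta> s S], of "3 * \<beta>"]
    by (simp add: power2_eq_square mult_ac)
qed

text \<open>Beyond each endpoint the curve continues as its second-order Taylor polynomial. This
  gives room for arrival times later than \<open>t\<close> and makes the derivative at
  \<open>t\<close> two-sided.\<close>

lemma C2_on_extend:
  fixes g :: "real \<Rightarrow> 'a::real_normed_vector"
  assumes "C2_on {0..t} g g' g''" "0 \<le> t"
  obtains f f' f'' where "C2_on UNIV f f' f''"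
    "\<And>s. s \<in> {0..t} \<Longrightarrow> f s = g s" "\<And>s. s \<in> {0..t} \<Longrightarrow> f' s = g' s"
proof -
  define T where "T = (\<lambda>c s. g c + (s - c) *\<^sub>R g' c + ((s - c)\<^sup>2 / 2) *\<^sub>R g'' c)"
  define T' where "T' = (\<lambda>c s. g' c + (s - c) *\<^sub>R g'' c)"
  have T: "C2_on S (T c) (T' c) (\<lambda>s. g'' c)" for S c
    unfolding T_def T'_def by (rule C2_on_quadratic)
  note 1 = C2_on_glue[OF assms(1) T[of "{t..}" t]]
  have "C2_on {0..} (\<lambda>s. if s \<in> {0..t} then g s else T t s) (\<lambda>s. if s \<in> {0..t} then g' s else T' t s)
     (\<lambda>s. if s \<in> {0..t} then g'' s else g'' t)"
  proof -
    have "{0..t} \<union> {t..} = {0..}" using assms by auto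
    then show ?thesis using 1 by (auto simp: T_def T'_def)
  qed
  note 2 = C2_on_glue[OF this T[of "{..0}" 0]]
  show thesis
  proof (rule that)
    have "{0::real..} \<union> {..0} = UNIV" by auto
    with 2 show "C2_on UNIV (\<lambda>s. if s \<in> {0..} then (if s \<in> {0..t} then g s else T t s) else T 0 s)
       (\<lambda>s. if s \<in> {0..} then (if s \<in> {0..t} then g' s else T' t s) else T' 0 s)
       (\<lambda>s. if s \<in> {0..} then (if s \<in> {0..t} then g'' s else g'' t) else g'' 0)"
      using assms(2) by (auto simp: T_def T'_def)
  qed auto
qed

lemma velocity_eq:
  assumes "C2_on {0..t} g g' g''" "0 < t" "s \<in> {0..t}"
  shows "velocity t g s = g' s"
  unfolding velocity_def
  by (rule vector_derivative_within_cbox[of 0 t, unfolded box_real, OF assms(2,3)])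
    (use assms in \<open>auto simp: C2_on_def\<close>)

section \<open>First-order upper bounds\<close>

text \<open>Membership in \<open>superdiff\<close> without extended reals. Since \<epsilon> is fixed
  before anything else, the competitors may use a cut-off whose width depends on \<epsilon>; this
  replaces a separate limit of vanishing width.\<close>

definition supports_above :: "('a::real_inner \<Rightarrow> real) \<Rightarrow> 'a \<Rightarrow> 'a \<Rightarrow> bool" where
  "supports_above f a q \<longleftrightarrow>
     (\<forall>\<epsilon>>0. \<exists>\<rho>>0. \<forall>b. norm (b - a) < \<rho> \<longrightarrow> f b \<le> f a + q \<bullet> (b - a) + \<epsilon> * norm (b - a))"

lemma supports_aboveE:
  assumes "supports_above f a q" "0 < \<epsilon>"
  obtains \<rho> where "0 < \<rho>"
    "\<And>b. norm (b - a) < \<rho> \<Longrightarrow> f b \<le> f a + q \<bullet> (b - a) + \<epsilon> * norm (b - a)"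
proof -
  have "\<exists>\<rho>>0. \<forall>b. norm (b - a) < \<rho> \<longrightarrow> f b \<le> f a + q \<bullet> (b - a) + \<epsilon> * norm (b - a)"
    using assms by (simp add: supports_above_def)
  then show thesis using that by blast
qed

lemma supports_above_imp_superdiff:
  assumes "supports_above f a q"
  shows "q \<in> superdiff f a"
proof -
  have "Limsup (at a) (\<lambda>b. ereal ((f b - f a - q \<bullet> (b - a)) / norm (b - a))) \<le> 0 + ereal \<epsilon>"
    if "\<epsilon> > 0" for \<epsilon>
  proof (rule Limsup_bounded)
    obtain \<rho> where "\<rho> > 0"
      and \<rho>: "\<And>b. norm (b - a) < \<rho> \<Longrightarrow> f b \<le> f a + q \<bullet> (b - a) + \<epsilon> * norm (b - a)"
      using supports_aboveE[OF assms \<open>\<epsilon> > 0\<close>] by metis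
    show "\<forall>\<^sub>F b in at a. ereal ((f b - f a - q \<bullet> (b - a)) / norm (b - a)) \<le> 0 + ereal \<epsilon>"
      unfolding eventually_at
    proof (intro exI[of _ \<rho>] conjI ballI impI)
      fix b assume "b \<noteq> a \<and> dist b a < \<rho>"
      then show "ereal ((f b - f a - q \<bullet> (b - a)) / norm (b - a)) \<le> 0 + ereal \<epsilon>"
        using \<rho>[of b] by (simp add: dist_norm field_simps)
    qed fact
  qed
  then show ?thesis
    unfolding superdiff_def by (auto intro: ereal_le_epsilon2)
qed

text \<open>Along \<open>a + \<tau> *\<^sub>R h\<close> the upper bound and differentiability give
  \<open>D h \<le> q \<bullet> h\<close> up to two errors of size \<eta>; the same for
  \<open>- h\<close> turns the inequality into an equality.\<close>

lemma supports_above_imp_derivative_eq: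
  assumes "supports_above f a q" and D: "(f has_derivative D) (at a)"
  shows "D h = q \<bullet> h"
proof -
  interpret D: bounded_linear D by (rule has_derivative_bounded_linear[OF D])
  have le: "D h \<le> q \<bullet> h" for h
  proof (rule field_le_epsilon)
    fix \<epsilon> :: real assume "\<epsilon> > 0"
    define \<eta> where "\<eta> = \<epsilon> / (2 * (norm h + 1))"
    have "norm h + 1 > 0" using norm_ge_zero[of h] by linarith
    then have "\<eta> > 0" using \<open>\<epsilon> > 0\<close> by (simp add: \<eta>_def)
    obtain \<rho> where "\<rho> > 0"
      and \<rho>: "\<And>b. norm (b - a) < \<rho> \<Longrightarrow> f b \<le> f a + q \<bullet> (b - a) + \<eta> * norm (b - a)"
      using supports_aboveE[OF assms(1) \<open>\<eta> > 0\<close>] by metis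
    obtain \<sigma> where "\<sigma> > 0"
      and \<sigma>: "\<And>b. norm (b - a) < \<sigma> \<Longrightarrow> norm (f b - f a - D (b - a)) \<le> \<eta> * norm (b - a)"
      using D \<open>\<eta> > 0\<close> unfolding has_derivative_at_alt by blast
    define \<tau> where "\<tau> = min \<rho> \<sigma> / (2 * (norm h + 1))"
    have \<tau>: "\<tau> > 0" "\<tau> * norm h < min \<rho> \<sigma>"
    proof -
      show "\<tau> > 0" using \<open>\<rho> > 0\<close> \<open>\<sigma> > 0\<close> \<open>norm h + 1 > 0\<close> by (simp add: \<tau>_def)
      have "\<tau> * norm h \<le> \<tau> * (norm h + 1)" using \<open>\<tau> > 0\<close> by (intro mult_left_mono) auto
      also have "\<dots> = min \<rho> \<sigma> / 2" using \<open>norm h + 1 > 0\<close> by (simp add: \<tau>_def field_simps)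
      also have "\<dots> < min \<rho> \<sigma>" using \<open>\<rho> > 0\<close> \<open>\<sigma> > 0\<close> by linarith
      finally show "\<tau> * norm h < min \<rho> \<sigma>" .
    qed
    have "\<tau> * D h \<le> \<tau> * (q \<bullet> h) + 2 * \<eta> * (\<tau> * norm h)"
      using \<rho>[of "a + \<tau> *\<^sub>R h"] \<sigma>[of "a + \<tau> *\<^sub>R h"] \<tau> by (simp add: D.scaleR abs_le_iff)
    also have "\<dots> = \<tau> * (q \<bullet> h + 2 * \<eta> * norm h)" by (simp add: algebra_simps)
    finally have "D h \<le> q \<bullet> h + 2 * \<eta> * norm h" using \<tau>(1) by simp
    also have "2 * \<eta> * norm h \<le> 2 * \<eta> * (norm h + 1)"
      using \<open>\<eta> > 0\<close> by (intro mult_left_mono) auto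
    also have "2 * \<eta> * (norm h + 1) = \<epsilon>"
      using \<open>norm h + 1 > 0\<close> by (simp add: \<eta>_def divide_eq_eq)
    finally show "D h \<le> q \<bullet> h + \<epsilon>" by simp
  qed
  show ?thesis using le[of h] le[of "- h"] by (simp add: D.neg)
qed

lemma GDERIV_grad: "GDERIV f a :> q \<Longrightarrow> grad f a = q"
  unfolding grad_def
proof (rule the_equality)
  fix D assume "GDERIV f a :> q" "GDERIV f a :> D"
  then have "(\<lambda>h. h \<bullet> D) = (\<lambda>h. h \<bullet> q)"
    unfolding gderiv_def by (rule has_derivative_unique[rotated])
  then show "D = q" by (simp add: fun_eq_iff vector_eq_ldot)
qed

lemma supports_above_imp_grad:
  assumes "supports_above f a q" "f differentiable (at a)"
  shows "grad f a = q"
proof -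
  obtain D where D: "(f has_derivative D) (at a)"
    using assms(2) by (auto simp: differentiable_def)
  have "D = (\<lambda>h. h \<bullet> q)"
    using supports_above_imp_derivative_eq[OF assms(1) D] by (auto simp: inner_commute)
  with D show ?thesis by (intro GDERIV_grad) (simp add: gderiv_def)
qed

lemma supports_above_imp_deriv:
  fixes q :: real
  assumes "supports_above f a q" "f differentiable (at a)"
  shows "deriv f a = q"
proof -
  obtain D where D: "(f has_derivative D) (at a)"
    using assms(2) by (auto simp: differentiable_def)
  have "D = (*) q"
    using supports_above_imp_derivative_eq[OF assms(1) D] by auto
  with D show ?thesis by (intro DERIV_imp_deriv) (simp add: has_field_derivative_def)
qed

text \<open>Chord slopes from \<open>v\<close> towards \<open>w\<close> are at most
  \<open>f w - f v\<close>, and they tend to \<open>D (w - v)\<close> as the parameter decreases to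
  0.\<close>

lemma strictly_convex_above_tangent:
  assumes "strictly_convex f" and D: "(f has_derivative D) (at v)"
  shows "f v + D (w - v) \<le> f w"
proof (cases "w = v")
  case False
  have chord: "(f (v + c *\<^sub>R (w - v)) - f v) / c \<le> f w - f v" if "0 < c" "c < 1" for c
  proof -
    have "f ((1 - c) *\<^sub>R v + c *\<^sub>R w) < (1 - c) * f v + c * f w"
      using assms(1) False that unfolding strictly_convex_def by metis
    then show ?thesis using that by (simp add: field_simps)
  qed
  have "((\<lambda>c. f (v + c *\<^sub>R (w - v))) has_derivative (\<lambda>c. D (c *\<^sub>R (w - v)))) (at 0)"
    by (rule has_derivative_compose[where g = f and f = "\<lambda>c. v + c *\<^sub>R (w - v)"])
      (auto intro!: derivative_eq_intros D)
  moreover have "(\<lambda>c. D (c *\<^sub>R (w - v))) = (*) (D (w - v))"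
    using bounded_linear.linear[OF has_derivative_bounded_linear[OF D]]
    by (auto simp: linear_cmul)
  ultimately have "((\<lambda>c. f (v + c *\<^sub>R (w - v))) has_real_derivative D (w - v)) (at 0)"
    by (simp add: has_field_derivative_def)
  then have "((\<lambda>c. (f (v + c *\<^sub>R (w - v)) - f v) / c) \<longlongrightarrow> D (w - v)) (at 0)"
    by (simp add: has_field_derivative_iff)
  then have "((\<lambda>c. (f (v + c *\<^sub>R (w - v)) - f v) / c) \<longlongrightarrow> D (w - v)) (at_right 0)"
    by (rule filterlim_mono) (auto intro: at_le)
  then have "D (w - v) \<le> f w - f v"
  proof (rule tendsto_upperbound)
    show "\<forall>\<^sub>F c in at_right 0. (f (v + c *\<^sub>R (w - v)) - f v) / c \<le> f w - f v"
      unfolding eventually_at_right_field using chord by (intro exI[of _ 1]) auto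
  qed auto
  then show ?thesis by simp
qed (use D in \<open>auto simp: linear_0 dest: bounded_linear.linear[OF has_derivative_bounded_linear]\<close>)

declare Lv.simps [simp del] Lu.simps [simp del] Ham.simps [simp del]

section \<open>Characteristic equation and fundamental solution\<close>

text \<open>The derivative is a continuous map \<open>L'\<close> into bounded linear maps, because
  the first variation needs a linearization error that is uniform along a whole curve; the partial
  derivatives are read off from it.\<close>

locale contact_lagrangian =
  fixes L :: "'a::euclidean_space \<times> 'a \<times> real \<Rightarrow> real"
    and L' :: "'a \<times> 'a \<times> real \<Rightarrow> ('a \<times> 'a \<times> real) \<Rightarrow>\<^sub>L real"
    and K c :: real
  assumes has_derivative_L: "(L has_derivative blinfun_apply (L' z)) (at z)"
    and continuous_L': "continuous_on UNIV L'"
    and K_pos: "0 < K"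
    and Lu_bound: "\<bar>Lu L (x, v, r)\<bar> \<le> K"
    and c_nonneg: "0 \<le> c"
    and L_ge: "- c \<le> L (x, v, 0)"
begin

lemma continuous_on_L [continuous_intros]:
  "continuous_on S f \<Longrightarrow> continuous_on S (\<lambda>s. L (f s))"
proof -
  have "continuous_on UNIV L"
    by (rule has_derivative_continuous_on) (rule has_derivative_at_withinI[OF has_derivative_L])
  then show "continuous_on S (\<lambda>s. L (f s))" if "continuous_on S f"
    by (rule continuous_on_compose2[OF _ that]) simp
qed

lemma Lu_eq: "Lu L (x, v, r) = blinfun_apply (L' (x, v, r)) (0, 0, 1)"
proof -
  have "((\<lambda>q. L (x, v, q)) has_derivative (\<lambda>h. blinfun_apply (L' (x, v, r)) (0, 0, h))) (at r)"
    by (rule has_derivative_compose[where f = "\<lambda>q. (x, v, q)" and g = L])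
      (auto intro!: derivative_eq_intros has_derivative_L)
  moreover have "(\<lambda>h. blinfun_apply (L' (x, v, r)) (0, 0, h)) = (*) (blinfun_apply (L' (x, v, r)) (0, 0, 1))"
  proof
    fix h
    show "blinfun_apply (L' (x, v, r)) (0, 0, h) = blinfun_apply (L' (x, v, r)) (0, 0, 1) * h"
      using blinfun.scaleR_right[of "L' (x, v, r)" h "(0, 0, 1)"] by simp
  qed
  ultimately have "((\<lambda>q. L (x, v, q)) has_real_derivative blinfun_apply (L' (x, v, r)) (0, 0, 1)) (at r)"
    by (simp add: has_field_derivative_def)
  then show ?thesis by (simp add: Lu.simps DERIV_imp_deriv)
qed

lemma has_derivative_L_v:
  "((\<lambda>w. L (x, w, r)) has_derivative (\<lambda>h. blinfun_apply (L' (x, v, r)) (0, h, 0))) (at v)"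
  by (rule has_derivative_compose[where f = "\<lambda>w. (x, w, r)" and g = L])
    (auto intro!: derivative_eq_intros has_derivative_L)

text \<open>\<open>Lv\<close> is a gradient given by a definite description, so a representing
  vector must be produced first: the adjoint of the functional, applied to 1, is its Riesz
  representative.\<close>

lemma L'_velocity: "blinfun_apply (L' (x, v, r)) (0, h, 0) = Lv L (x, v, r) \<bullet> h"
proof -
  let ?D = "\<lambda>h. blinfun_apply (L' (x, v, r)) (0, h, 0)"
  define q where "q = adjoint ?D 1"
  have "linear ?D"
    using bounded_linear.linear has_derivative_bounded_linear[OF has_derivative_L_v] by blast
  from adjoint_works[OF this, of _ 1] have q: "?D h = h \<bullet> q" for h
    by (simp add: q_def)
  have "GDERIV (\<lambda>w. L (x, w, r)) v :> q"
    using has_derivative_L_v[of x r v] by (simp add: gderiv_def q)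
  then have "Lv L (x, v, r) = q" by (simp add: Lv.simps GDERIV_grad)
  with q show ?thesis by (simp add: inner_commute)
qed

text \<open>The position part stays an unexpanded functional: only a bound for it matters, since the
  cut-off multiplies it by a factor with small integral.\<close>

lemma L'_split:
  "blinfun_apply (L' z) (\<alpha>, \<beta>, \<gamma>) = blinfun_apply (L' z) (\<alpha>, 0, 0) + Lv L z \<bullet> \<beta> + Lu L z * \<gamma>"
proof -
  obtain x v r where z: "z = (x, v, r)" by (metis prod.exhaust)
  have "(\<alpha>, \<beta>, \<gamma>) = (\<alpha>, 0, 0) + (0, \<beta>, 0) + \<gamma> *\<^sub>R (0, 0, 1)" by simp
  then have "blinfun_apply (L' z) (\<alpha>, \<beta>, \<gamma>) = blinfun_apply (L' z) (\<alpha>, 0, 0)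
      + blinfun_apply (L' z) (0, \<beta>, 0) + \<gamma> *\<^sub>R blinfun_apply (L' z) (0, 0, 1)"
    by (metis blinfun.add_right blinfun.scaleR_right)
  then show ?thesis by (simp add: z L'_velocity Lu_eq mult.commute)
qed

lemma continuous_on_Lu [continuous_intros]:
  assumes "continuous_on S f"
  shows "continuous_on S (\<lambda>s. Lu L (f s))"
proof -
  have "Lu L = (\<lambda>z. blinfun_apply (L' z) (0, 0, 1))" by (auto simp: Lu_eq fun_eq_iff)
  then show ?thesis
    by (auto intro!: continuous_intros continuous_on_compose2[OF continuous_L' assms])
qed

lemma continuous_on_Lv [continuous_intros]:
  assumes "continuous_on S f"
  shows "continuous_on S (\<lambda>s. Lv L (f s))"
proof -
  have "Lv L = (\<lambda>z. \<Sum>i\<in>Basis. blinfun_apply (L' z) (0, i, 0) *\<^sub>R i)"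
    by (auto simp: L'_velocity fun_eq_iff euclidean_representation)
  then show ?thesis
    by (auto intro!: continuous_intros continuous_on_compose2[OF continuous_L' assms])
qed

lemma L_lipschitz_r: "\<bar>L (x, v, r) - L (x, v, r')\<bar> \<le> K * \<bar>r - r'\<bar>"
proof -
  have "norm (L (x, v, r) - L (x, v, r')) \<le> K * norm (r - r')"
  proof (rule field_differentiable_bound[of UNIV])
    fix q
    have "((\<lambda>q. L (x, v, q)) has_derivative (\<lambda>h. blinfun_apply (L' (x, v, q)) (0, 0, h))) (at q)"
      by (rule has_derivative_compose[where f = "\<lambda>q. (x, v, q)" and g = L])
        (auto intro!: derivative_eq_intros has_derivative_L)
    moreover have "blinfun_apply (L' (x, v, q)) (0, 0, h) = Lu L (x, v, q) * h" for h
      using L'_split[of "(x, v, q)" 0 0 h] blinfun.zero_right[of "L' (x, v, q)"]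
      by (simp add: zero_prod_def)
    ultimately show "((\<lambda>q. L (x, v, q)) has_field_derivative Lu L (x, v, q)) (at q within UNIV)"
      by (simp add: has_field_derivative_def)
    show "norm (Lu L (x, v, q)) \<le> K" by (simp add: Lu_bound)
  qed auto
  then show ?thesis by simp
qed

lemma L_lower_bound: "- c - K * \<bar>r\<bar> \<le> L (x, v, r)"
  using L_lipschitz_r[of x v r 0] L_ge[of x v] by (simp add: abs_le_iff)

text \<open>The velocity is a separate argument and the initial value is left open, so that passing
  to a shorter interval or to another curve never involves \<open>velocity\<close>.\<close>

definition solves where
  "solves b g g' w \<longleftrightarrow>
     (\<forall>s\<in>{0..b}. (w has_real_derivative L (g s, g' s, w s)) (at s within {0..b}))"

lemma solves_subset: "solves b g g' w \<Longrightarrow> a \<le> b \<Longrightarrow> solves a g g' w"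
  unfolding solves_def by (auto intro: DERIV_subset[of _ _ _ "{0..b}" "{0..a}"])

lemma solves_cong:
  assumes "solves b g g' w" "\<And>s. s \<in> {0..b} \<Longrightarrow> f s = g s \<and> f' s = g' s"
  shows "solves b f f' w"
  using assms by (simp add: solves_def)

lemma solves_continuous_on: "solves b g g' w \<Longrightarrow> continuous_on {0..b} w"
  unfolding solves_def by (rule DERIV_continuous_on) blast

lemma solves_exists:
  assumes "continuous_on {0..b} g" "continuous_on {0..b} g'" "0 \<le> b"
  obtains w where "solves b g g' w" "w 0 = u"
proof -
  have "continuous_on ({0..b} \<times> UNIV) (\<lambda>(s, w). L (g s, g' s, w))"
    unfolding split_beta
    by (intro continuous_intros continuous_on_compose2[OF assms(1)] continuous_on_compose2[OF assms(2)])
      auto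
  then obtain w where "w 0 = u"
    "\<And>s. s \<in> {0..b} \<Longrightarrow> (w has_real_derivative L (g s, g' s, w s)) (at s within {0..b})"
    using picard_global[of b K "\<lambda>s w. L (g s, g' s, w)" u] assms(3) K_pos L_lipschitz_r by metis
  then show thesis by (intro that[of w]) (auto simp: solves_def)
qed

text \<open>Supersolution principle: where \<open>W < w\<close>, the inequality for \<open>W\<close>
  and the Lipschitz bound leave at most \<open>K * (w - W)\<close>. Competitors are estimated by
  exhibiting such a \<open>W\<close>.\<close>

lemma solves_le:
  assumes "\<And>s. s \<in> {a..b} \<Longrightarrow> (w has_real_derivative L (g s, g' s, w s)) (at s within {a..b})"
    and "\<And>s. s \<in> {a..b} \<Longrightarrow> (W has_real_derivative W' s) (at s within {a..b})"
    and "\<And>s. s \<in> {a..b} \<Longrightarrow> L (g s, g' s, W s) \<le> W' s"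
    and "w a \<le> W a" "s \<in> {a..b}"
  shows "w s \<le> W s"
proof (rule ode_comparison[OF assms(1,2) _ assms(4,5), where K = K])
  fix s assume "s \<in> {a..b}" "W s < w s"
  then show "L (g s, g' s, w s) - W' s \<le> K * (w s - W s)"
    using assms(3)[of s] L_lipschitz_r[of "g s" "g' s" "w s" "W s"] by (simp add: abs_le_iff)
qed

text \<open>The gap can shrink at most exponentially with rate \<open>K\<close>: adding the decaying
  gap \<open>d\<close> to \<open>v\<close> still leaves it below \<open>w\<close>. Strictness later
  carries a gain at an intermediate time to the final time.\<close>

lemma solves_less:
  assumes v: "\<And>s. s \<in> {a..b} \<Longrightarrow> (v has_real_derivative L (g s, g' s, v s)) (at s within {a..b})"
    and w: "\<And>s. s \<in> {a..b} \<Longrightarrow> (w has_real_derivative L (g s, g' s, w s)) (at s within {a..b})"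
    and "v a < w a" "s \<in> {a..b}"
  shows "v s < w s"
proof -
  define d where "d = (\<lambda>s. (w a - v a) * exp (- K * (s - a)))"
  have d: "d s > 0" for s using assms by (simp add: d_def)
  have "v s + d s \<le> w s"
  proof (rule ode_comparison[of a b "\<lambda>s. v s + d s" "\<lambda>s. L (g s, g' s, v s) - K * d s" w
        "\<lambda>s. L (g s, g' s, w s)" K])
    show "((\<lambda>s. v s + d s) has_real_derivative L (g s, g' s, v s) - K * d s) (at s within {a..b})"
      if "s \<in> {a..b}" for s
      unfolding d_def using v[OF that] by (auto intro!: derivative_eq_intros)
    fix s assume "s \<in> {a..b}" "w s < v s + d s"
    moreover have "L (g s, g' s, v s) - L (g s, g' s, w s) \<le> K * (v s + d s - w s) + K * d s"
    proof -
      have "\<bar>v s - w s\<bar> \<le> (v s + d s - w s) + d s"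
        using d[of s] calculation by auto
      then have "K * \<bar>v s - w s\<bar> \<le> K * ((v s + d s - w s) + d s)"
        using K_pos by (intro mult_left_mono) auto
      then show ?thesis
        using L_lipschitz_r[of "g s" "g' s" "v s" "w s"] by (simp add: algebra_simps)
    qed
    ultimately show "L (g s, g' s, v s) - K * d s - L (g s, g' s, w s) \<le> K * (v s + d s - w s)"
      by simp
  qed (use assms in \<open>auto simp: d_def\<close>)
  with d[of s] show ?thesis by simp
qed

lemma solves_unique:
  assumes "solves b g g' v" "solves b g g' w" "v 0 = w 0" "s \<in> {0..b}"
  shows "v s = w s"
  by (rule antisym; rule solves_le[where a = 0 and b = b and g = g and g' = g'])
    (use assms in \<open>auto simp: solves_def\<close>)

lemma is_char_sol_iff:
  assumes "C2_on {0..t} g g' g''" "0 < t"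
  shows "is_char_sol L t g u w \<longleftrightarrow> w 0 = u \<and> solves t g g' w"
  using velocity_eq[OF assms] by (auto simp: is_char_sol_def solves_def lift_def)

text \<open>\<open>char_sol\<close> is an arbitrary choice, so uniqueness first identifies its value
  at \<open>t\<close> with that of \<open>w\<close>; the integrand being its derivative, the action
  telescopes.\<close>

lemma action_eq:
  assumes g: "C2_on {0..t} g g' g''" "0 < t" and w: "solves t g g' w" "w 0 = u"
  shows "action L t g u = w t - u"
proof -
  define v where "v = char_sol L t g u"
  have "is_char_sol L t g u v"
    unfolding v_def char_sol_def by (rule someI[of _ w]) (use w is_char_sol_iff[OF g] in auto)
  then have v: "solves t g g' v" "v 0 = u" using is_char_sol_iff[OF g] by auto
  have "((\<lambda>s. L (lift t g v s)) has_integral v t - v 0) {0..t}"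
  proof (rule fundamental_theorem_of_calculus)
    fix s assume s: "s \<in> {0..t}"
    with v show "(v has_vector_derivative L (lift t g v s)) (at s within {0..t})"
      by (simp add: solves_def lift_def velocity_eq[OF g s] has_real_derivative_iff_has_vector_derivative)
  qed (use g in simp)
  then show ?thesis
    using solves_unique[OF v(1) w(1), of t] v w g
    by (simp add: action_def v_def[symmetric] integral_unique)
qed

text \<open>The bound is independent of the curve, which is what makes the real infimum in
  \<open>fund_sol\<close> meaningful.\<close>

lemma action_lower_bound:
  assumes "g \<in> curves t x y" "0 < t"
  shows "c / K - (\<bar>u\<bar> + c / K) * exp (K * t) - u \<le> action L t g u"
proof -
  obtain g' g'' where g: "C2_on {0..t} g g' g''"
    using assms by (auto simp: curves_def C2_curve_iff_C2_on)
  obtain w where w: "solves t g g' w" "w 0 = u"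
    using solves_exists[of t g g' u] C2_on_imp_continuous_on[OF g] assms by auto
  have "c / K - (\<bar>w 0\<bar> + c / K) * exp (K * t) \<le> w t"
  proof (rule ode_ge_exp)
    show "(w has_real_derivative L (g s, g' s, w s)) (at s within {0..t})" if "s \<in> {0..t}" for s
      using w that by (auto simp: solves_def)
    show "- c - K * \<bar>w s\<bar> \<le> L (g s, g' s, w s)" for s
      by (rule L_lower_bound)
  qed (use K_pos c_nonneg assms in auto)
  then show ?thesis using action_eq[OF g assms(2) w] w by simp
qed

lemma fund_sol_le:
  assumes g: "C2_on {0..t} g g' g''" "0 < t" and w: "solves t g g' w" "w 0 = u"
    and "g 0 = x" "g t = y"
  shows "fund_sol L t x y u \<le> w t - u"
proof -
  have "bdd_below ((\<lambda>\<xi>. action L t \<xi> u) ` curves t x y)"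
    using action_lower_bound[OF _ g(2)] by (intro bdd_belowI2)
  moreover have "g \<in> curves t x y"
    using assms by (auto simp: curves_def C2_curve_iff_C2_on)
  ultimately have "fund_sol L t x y u \<le> action L t g u"
    unfolding fund_sol_def by (rule cINF_lower)
  with action_eq[OF g w] show ?thesis by simp
qed

lemma fund_sol_ge:
  assumes "curves t x y \<noteq> {}" "0 < t"
    and "\<And>g g' g'' w. C2_on {0..t} g g' g'' \<Longrightarrow> g 0 = x \<Longrightarrow> g t = y \<Longrightarrow>
      solves t g g' w \<Longrightarrow> w 0 = u \<Longrightarrow> m \<le> w t - u"
  shows "m \<le> fund_sol L t x y u"
  unfolding fund_sol_def
proof (rule cINF_greatest[OF assms(1)])
  fix g assume "g \<in> curves t x y"
  then obtain g' g'' where g: "C2_on {0..t} g g' g''" "g 0 = x" "g t = y"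
    by (auto simp: curves_def C2_curve_iff_C2_on)
  obtain w where w: "solves t g g' w" "w 0 = u"
    using solves_exists[of t g g' u] C2_on_imp_continuous_on[OF g(1)] assms by auto
  show "m \<le> action L t g u"
    using assms(3)[OF g w] action_eq[OF g(1) assms(2) w] by simp
qed

section \<open>First variation of the characteristic solution\<close>

text \<open>Mean value inequality on a small ball. \<open>L'\<close> is uniformly continuous on the
  closed ball of radius \<open>R + 1\<close>; the additional 1 keeps \<open>z + h\<close> inside for
  all \<open>z\<close> in \<open>Z\<close>.\<close>

lemma uniform_linearization:
  assumes "compact Z" "0 < \<epsilon>"
  obtains \<rho> where "0 < \<rho>"
    "\<And>z h. z \<in> Z \<Longrightarrow> norm h < \<rho> \<Longrightarrow> L (z + h) \<le> L z + blinfun_apply (L' z) h + \<epsilon> * norm h"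
proof -
  obtain R where R: "\<And>z. z \<in> Z \<Longrightarrow> norm z \<le> R"
    using compact_imp_bounded[OF assms(1)] by (auto simp: bounded_iff)
  have "uniformly_continuous_on (cball 0 (R + 1)) L'"
    by (intro compact_uniformly_continuous continuous_on_subset[OF continuous_L']) auto
  then obtain \<sigma> where "\<sigma> > 0"
    and \<sigma>: "\<And>x z. x \<in> cball 0 (R + 1) \<Longrightarrow> z \<in> cball 0 (R + 1) \<Longrightarrow> dist x z < \<sigma> \<Longrightarrow> dist (L' x) (L' z) < \<epsilon>"
    unfolding uniformly_continuous_on_def using assms(2) by metis
  show thesis
  proof
    show "0 < min 1 \<sigma>" using \<open>\<sigma> > 0\<close> by simp
    fix z h :: "'a \<times> 'a \<times> real"
    assume z: "z \<in> Z" and h: "norm h < min 1 \<sigma>"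
    have "norm (L (z + h) - L z - blinfun_apply (L' z) (z + h - z)) \<le> norm (z + h - z) * \<epsilon>"
    proof (rule differentiable_bound_linearization[where S = "ball z (min 1 \<sigma>)" and f' = "\<lambda>z. blinfun_apply (L' z)"])
      fix x assume x: "x \<in> ball z (min 1 \<sigma>)"
      show "(L has_derivative blinfun_apply (L' x)) (at x within ball z (min 1 \<sigma>))"
        by (rule has_derivative_at_withinI[OF has_derivative_L])
      have "norm x \<le> norm z + norm (x - z)" using norm_triangle_ineq[of z "x - z"] by simp
      then have "dist (L' x) (L' z) < \<epsilon>"
        using x R[OF z] by (intro \<sigma>) (auto simp: dist_commute dist_norm norm_minus_commute)
      then show "onorm (blinfun_apply (L' x) - blinfun_apply (L' z)) \<le> \<epsilon>"
        by (simp add: dist_norm norm_blinfun.rep_eq minus_blinfun.rep_eq fun_diff_def)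
    next
      fix s :: real assume "s \<in> {0..1}"
      then have "\<bar>s\<bar> * norm h \<le> 1 * norm h" by (intro mult_right_mono) auto
      then show "z + s *\<^sub>R (z + h - z) \<in> ball z (min 1 \<sigma>)"
        using h by (auto simp: dist_norm)
    qed (use \<open>\<sigma> > 0\<close> in auto)
    then show "L (z + h) \<le> L z + blinfun_apply (L' z) h + \<epsilon> * norm h"
      by (simp add: abs_le_iff mult.commute)
  qed
qed

text \<open>The bound is a supersolution of the characteristic equation along the perturbed curve. It
  needs \<open>P\<close> to solve the linearized equation only up to the defect \<open>m'\<close>, so that explicit \<open>P\<close>
  can be used and no Euler--Lagrange equation enters.\<close>

lemma variation_bound:
  fixes P P' :: "real \<Rightarrow> 'a" and \<phi> \<phi>' J m m' :: "real \<Rightarrow> real"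
  assumes w0: "solves b g g' w0" and "0 \<le> b"
    and cont: "continuous_on {0..b} g" "continuous_on {0..b} g'"
      "continuous_on {0..b} \<phi>" "continuous_on {0..b} \<phi>'"
    and J: "\<And>s. s \<in> {0..b} \<Longrightarrow> (J has_real_derivative Lu L (g s, g' s, w0 s) * J s) (at s within {0..b})"
    and P: "\<And>s. s \<in> {0..b} \<Longrightarrow> (P has_vector_derivative P' s) (at s within {0..b})"
    and m: "\<And>s. s \<in> {0..b} \<Longrightarrow> (m has_real_derivative m' s) (at s within {0..b})"
      "\<And>s. s \<in> {0..b} \<Longrightarrow> 0 \<le> m s" "\<And>s. s \<in> {0..b} \<Longrightarrow> 0 \<le> m' s"
    and defect: "\<And>s e. s \<in> {0..b} \<Longrightarrow>
      blinfun_apply (L' (g s, g' s, w0 s)) (\<phi> s *\<^sub>R e, \<phi>' s *\<^sub>R e, P s \<bullet> e) - P' s \<bullet> e \<le> m' s * norm e"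
    and "0 < \<epsilon>"
  obtains \<rho> where "0 < \<rho>"
    "\<And>e r w s. norm e + \<bar>r\<bar> < \<rho> \<Longrightarrow>
       solves b (\<lambda>s. g s + \<phi> s *\<^sub>R e) (\<lambda>s. g' s + \<phi>' s *\<^sub>R e) w \<Longrightarrow>
       w 0 \<le> w0 0 + P 0 \<bullet> e + r * J 0 \<Longrightarrow> s \<in> {0..b} \<Longrightarrow>
       w s \<le> w0 s + P s \<bullet> e + r * J s + (m s + \<epsilon>) * (norm e + \<bar>r\<bar>) * exp ((K + 1) * s)"
proof -
  define z where "z = (\<lambda>s. (g s, g' s, w0 s))"
  \<comment> \<open>The rate \<open>K\<close> pays for \<open>Lu L\<close> acting on the correction
    \<eta>, the extra 1 for the linearization error \<open>\<epsilon> * N\<close>.\<close>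
  define E where "E = (\<lambda>s. exp ((K + 1) * s))"
  \<comment> \<open>Chosen so that the increment \<open>h\<close> below satisfies
    \<open>norm h \<le> B s * N\<close>; a linearization tolerance of \<open>\<epsilon> / M\<close>
    then costs \<open>\<epsilon> * N\<close>.\<close>
  define B where "B = (\<lambda>s. \<bar>\<phi> s\<bar> + \<bar>\<phi>' s\<bar> + norm (P s) + \<bar>J s\<bar> + (m s + \<epsilon>) * E s)"
  have Pc: "continuous_on {0..b} P"
    using P by (rule continuous_on_vector_derivative)
  have "continuous_on {0..b} B"
    unfolding B_def E_def
    by (intro continuous_intros cont Pc DERIV_continuous_on[OF J] DERIV_continuous_on[OF m(1)])
  then have "bounded (B ` {0..b})"
    by (intro compact_imp_bounded compact_continuous_image) auto
  then obtain M0 where M0: "\<forall>s\<in>{0..b}. \<bar>B s\<bar> \<le> M0" by (auto simp: bounded_iff)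
  define M where "M = \<bar>M0\<bar> + 1"
  have "M > 0" by (simp add: M_def)
  have M: "B s \<le> M" if "s \<in> {0..b}" for s using M0 that by (force simp: M_def)
  have "compact (z ` {0..b})"
    unfolding z_def
    by (intro compact_continuous_image continuous_intros cont solves_continuous_on[OF w0]) auto
  then obtain \<rho> where "\<rho> > 0" and \<rho>: "\<And>s h. s \<in> {0..b} \<Longrightarrow> norm h < \<rho> \<Longrightarrow>
      L (z s + h) \<le> L (z s) + blinfun_apply (L' (z s)) h + \<epsilon> / M * norm h"
    using uniform_linearization[of "z ` {0..b}" "\<epsilon> / M"] \<open>\<epsilon> > 0\<close> \<open>M > 0\<close> by (metis divide_pos_pos imageI)
  show thesis
  proof
    show "0 < \<rho> / M" using \<open>\<rho> > 0\<close> \<open>M > 0\<close> by simp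
    fix e r w s
    assume small: "norm e + \<bar>r\<bar> < \<rho> / M"
      and w: "solves b (\<lambda>s. g s + \<phi> s *\<^sub>R e) (\<lambda>s. g' s + \<phi>' s *\<^sub>R e) w"
      and init: "w 0 \<le> w0 0 + P 0 \<bullet> e + r * J 0" and s: "s \<in> {0..b}"
    define N where "N = norm e + \<bar>r\<bar>"
    have N: "N \<ge> 0" "norm e \<le> N" "\<bar>r\<bar> \<le> N" "M * N < \<rho>"
      using small \<open>M > 0\<close> by (auto simp: N_def field_simps)
    define \<eta> where "\<eta> = (\<lambda>s. (m s + \<epsilon>) * N * E s)"
    define \<eta>' where "\<eta>' = (\<lambda>s. (m' s + (K + 1) * (m s + \<epsilon>)) * N * E s)"
    define W where "W = (\<lambda>s. w0 s + P s \<bullet> e + r * J s + \<eta> s)"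
    define W' where "W' = (\<lambda>s. L (z s) + P' s \<bullet> e + r * (Lu L (z s) * J s) + \<eta>' s)"
    have "w s \<le> W s"
    proof (rule solves_le[where a = 0 and b = b and w = w and W = W and W' = W'
          and g = "\<lambda>s. g s + \<phi> s *\<^sub>R e" and g' = "\<lambda>s. g' s + \<phi>' s *\<^sub>R e"])
      fix s assume s: "s \<in> {0..b}"
      show "(w has_real_derivative L (g s + \<phi> s *\<^sub>R e, g' s + \<phi>' s *\<^sub>R e, w s)) (at s within {0..b})"
        using w s by (simp add: solves_def)
      have P1: "((\<lambda>s. P s \<bullet> e) has_real_derivative P' s \<bullet> e) (at s within {0..b})"
        using bounded_linear.has_vector_derivative[OF bounded_linear_inner_left P[OF s]]
        by (simp add: has_real_derivative_iff_has_vector_derivative)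
      have \<eta>1: "(\<eta> has_real_derivative \<eta>' s) (at s within {0..b})"
        unfolding \<eta>_def \<eta>'_def E_def using m(1)[OF s]
        by (auto intro!: derivative_eq_intros simp: algebra_simps)
      have w01: "(w0 has_real_derivative L (z s)) (at s within {0..b})"
        using w0 s by (simp add: solves_def z_def)
      show "(W has_real_derivative W' s) (at s within {0..b})"
        unfolding W_def W'_def using J[OF s]
        by (intro DERIV_add DERIV_cmult w01 P1 \<eta>1) (simp add: z_def)
      define h where "h = (\<phi> s *\<^sub>R e, \<phi>' s *\<^sub>R e, P s \<bullet> e + r * J s + \<eta> s)"
      have E1: "E s \<ge> 1" using s K_pos by (simp add: E_def)
      have \<eta>0: "\<eta> s \<ge> 0" using m(2)[OF s] N \<open>\<epsilon> > 0\<close> E1 by (simp add: \<eta>_def)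
      have "norm h \<le> norm (\<phi> s *\<^sub>R e) + (norm (\<phi>' s *\<^sub>R e) + norm (P s \<bullet> e + r * J s + \<eta> s))"
        unfolding h_def by (meson norm_Pair_le add_left_mono order_trans)
      also have "\<dots> \<le> \<bar>\<phi> s\<bar> * norm e + (\<bar>\<phi>' s\<bar> * norm e + (norm (P s) * norm e + \<bar>r\<bar> * \<bar>J s\<bar> + \<eta> s))"
        using Cauchy_Schwarz_ineq2[of "P s" e] \<eta>0 abs_triangle_ineq[of "P s \<bullet> e" "r * J s"]
        by (auto simp: abs_mult)
      also have "\<dots> \<le> \<bar>\<phi> s\<bar> * N + (\<bar>\<phi>' s\<bar> * N + (norm (P s) * N + N * \<bar>J s\<bar> + \<eta> s))"
        using N by (intro add_mono mult_left_mono mult_right_mono) auto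
      also have "\<dots> = B s * N" by (simp add: B_def \<eta>_def algebra_simps)
      also have "\<dots> \<le> M * N" using M[OF s] N by (intro mult_right_mono) auto
      finally have h: "norm h \<le> M * N" .
      have zh: "z s + h = (g s + \<phi> s *\<^sub>R e, g' s + \<phi>' s *\<^sub>R e, W s)"
        by (simp add: z_def h_def W_def)
      have "L (z s + h) \<le> L (z s) + blinfun_apply (L' (z s)) h + \<epsilon> / M * norm h"
        using h N(4) by (intro \<rho> s) simp
      also have "\<epsilon> / M * norm h \<le> \<epsilon> / M * (M * N)"
        using h \<open>\<epsilon> > 0\<close> \<open>M > 0\<close> by (intro mult_left_mono) auto
      also have "\<epsilon> / M * (M * N) = \<epsilon> * N" using \<open>M > 0\<close> by simp
      also have "blinfun_apply (L' (z s)) h = blinfun_apply (L' (z s)) (\<phi> s *\<^sub>R e, \<phi>' s *\<^sub>R e, P s \<bullet> e)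
          + Lu L (z s) * (r * J s + \<eta> s)"
        unfolding h_def by (subst (1 2) L'_split) (simp add: algebra_simps)
      also have "\<dots> \<le> P' s \<bullet> e + m' s * N + Lu L (z s) * (r * J s) + K * \<eta> s"
      proof -
        have "Lu L (z s) * \<eta> s \<le> K * \<eta> s"
          using Lu_bound[of "g s" "g' s" "w0 s"] \<eta>0
          by (intro mult_right_mono) (auto simp: z_def abs_le_iff)
        moreover have "m' s * norm e \<le> m' s * N"
          using N m(3)[OF s] by (intro mult_left_mono) auto
        ultimately show ?thesis
          using defect[OF s, of e] by (simp add: z_def algebra_simps)
      qed
      finally have *: "L (z s + h) \<le> L (z s) + P' s \<bullet> e + Lu L (z s) * (r * J s)
          + (m' s * N + K * \<eta> s + \<epsilon> * N)" by (simp add: algebra_simps)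
      have "m' s * N * 1 \<le> m' s * N * E s"
        using m(3)[OF s] N E1 by (intro mult_left_mono) auto
      moreover have "\<epsilon> * N * 1 \<le> (m s + \<epsilon>) * N * E s"
        using m(2)[OF s] N E1 \<open>\<epsilon> > 0\<close> by (intro mult_mono mult_right_mono) auto
      \<comment> \<open>The three summands absorb the defect, the feedback through
        \<open>Lu L\<close> and the linearization error, in this order.\<close>
      moreover have "\<eta>' s = m' s * N * E s + K * \<eta> s + (m s + \<epsilon>) * N * E s"
        by (simp add: \<eta>'_def \<eta>_def algebra_simps)
      ultimately show "L (g s + \<phi> s *\<^sub>R e, g' s + \<phi>' s *\<^sub>R e, W s) \<le> W' s"
        unfolding zh[symmetric] W'_def using * by (simp add: algebra_simps)
    next
      have "\<eta> 0 \<ge> 0" using m(2)[of 0] N \<open>\<epsilon> > 0\<close> \<open>0 \<le> b\<close> by (simp add: \<eta>_def E_def)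
      with init show "w 0 \<le> W 0" by (simp add: W_def)
    qed (use s in auto)
    then show "w s \<le> w0 s + P s \<bullet> e + r * J s + (m s + \<epsilon>) * (norm e + \<bar>r\<bar>) * exp ((K + 1) * s)"
      by (simp add: W_def \<eta>_def N_def E_def)
  qed
qed

section \<open>Competitors near the final point, the initial point and the initial value\<close>

lemma L'_position_bound:
  assumes "continuous_on {0..b::real} z"
  obtains C where "0 < C"
    "\<And>s e. s \<in> {0..b} \<Longrightarrow> blinfun_apply (L' (z s)) (e, 0, 0) \<le> C * norm e"
proof -
  have "continuous_on {0..b} (\<lambda>s. L' (z s))"
    by (rule continuous_on_compose2[OF continuous_L' assms]) simp
  then obtain C where C: "0 < C" "\<And>s. s \<in> {0..b} \<Longrightarrow> norm (L' (z s)) \<le> C"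
    by (rule bounded_on_Icc) blast
  have "blinfun_apply (L' (z s)) (e, 0, 0) \<le> C * norm e" if "s \<in> {0..b}" for s e
  proof -
    have "norm (blinfun_apply (L' (z s)) (e, 0, 0)) \<le> norm (L' (z s)) * norm (e, 0::'a, 0::real)"
      by (rule norm_blinfun)
    also have "\<dots> \<le> C * norm e" using C(2)[OF that] by (auto simp: norm_Pair intro: mult_right_mono)
    finally show ?thesis by simp
  qed
  with C(1) show thesis by (rule that)
qed

text \<open>To be at \<open>z\<close> at time \<tau>, the curve is shifted by
  \<open>\<phi> s *\<^sub>R e\<close> with \<open>\<phi> \<tau> *\<^sub>R e = z - g \<tau>\<close>.
  The ansatz \<open>P s = \<phi> s *\<^sub>R q\<close> gives the first-order change
  \<open>q \<bullet> (z - g \<tau>)\<close>, whatever the value of \<open>\<phi> \<tau>\<close>;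
  expanding \<open>g\<close> and \<open>w0\<close> at \<open>t\<close> yields the coefficient of
  \<open>\<tau> - t\<close>. One estimate thus covers both space and time.\<close>

lemma fund_sol_endpoint_bound:
  assumes g: "C2_on UNIV g g' g''" and "0 < t"
    and w0: "solves (t + 1) g g' w0" "w0 0 = u" and "0 < \<epsilon>"
  defines "q \<equiv> Lv L (g t, g' t, w0 t)" and "l \<equiv> L (g t, g' t, w0 t)"
  obtains \<rho> where "0 < \<rho>" "\<rho> \<le> t"
    "\<And>\<tau> z. \<bar>\<tau> - t\<bar> < \<rho> \<Longrightarrow> norm (z - g t) < \<rho> \<Longrightarrow>
      fund_sol L \<tau> (g 0) z u \<le> w0 t - u + q \<bullet> (z - g t) + (l - q \<bullet> g' t) * (\<tau> - t)
         + \<epsilon> * (norm (z - g t) + \<bar>\<tau> - t\<bar>)"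
proof -
  define z0 where "z0 = (\<lambda>s. (g s, g' s, w0 s))"
  have gc: "continuous_on S g" "continuous_on S g'" for S
    using C2_on_imp_continuous_on[OF g] continuous_on_subset by blast+
  have z0c: "continuous_on {0..t+1} z0"
    unfolding z0_def by (intro continuous_intros gc solves_continuous_on[OF w0(1)])
  obtain C1 where C1: "0 < C1" "\<And>s e. s \<in> {0..t+1} \<Longrightarrow> blinfun_apply (L' (z0 s)) (e, 0, 0) \<le> C1 * norm e"
    using L'_position_bound[OF z0c] by metis
  \<comment> \<open>\<open>C1\<close> bounds the position derivative, \<open>K * norm q\<close> the
    action of \<open>Lu L\<close> on \<open>P\<close>; the defect contains both with the factor
    \<phi>.\<close>
  define C where "C = C1 + K * norm q"
  have "C > 0" using C1 K_pos by (auto simp: C_def intro: add_pos_nonneg)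
  define M where "M = norm (g' t) + 1"
  have "M \<ge> 1" by (simp add: M_def)
  \<comment> \<open>The 8 bounds \<open>1 / \<phi> \<tau>\<close>, \<open>M\<close> bounds the ratio
    of \<open>norm (z - g \<tau>)\<close> to \<open>N\<close>, and the exponential is the growth
    factor of \<open>variation_bound\<close>. The tolerances below give
    \<open>m \<tau> + \<epsilon>2 \<le> \<epsilon> / (2 * A)\<close>.\<close>
  define A where "A = 8 * M * exp ((K + 1) * (t + 1))"
  have "A > 0" using \<open>M \<ge> 1\<close> by (simp add: A_def)
  define \<epsilon>1 where "\<epsilon>1 = \<epsilon> / (64 * A)"
  define \<epsilon>2 where "\<epsilon>2 = \<epsilon> / (8 * A)"
  define \<epsilon>3 where "\<epsilon>3 = min 1 (\<epsilon> / (8 * (1 + norm q)))"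
  have nq: "1 + norm q > 0" by (simp add: add_pos_nonneg)
  have eps: "\<epsilon>1 > 0" "\<epsilon>2 > 0" "\<epsilon>3 > 0" "\<epsilon>3 \<le> 1"
    using \<open>\<epsilon> > 0\<close> \<open>A > 0\<close> nq by (auto simp: \<epsilon>1_def \<epsilon>2_def \<epsilon>3_def)

  have "continuous_on {0..t+1} (\<lambda>s. Lv L (z0 s))" by (intro continuous_intros z0c)
  then obtain \<delta>1 where "\<delta>1 > 0"
    and \<delta>1: "\<And>s. s \<in> {0..t+1} \<Longrightarrow> dist s t < \<delta>1 \<Longrightarrow> dist (Lv L (z0 s)) (Lv L (z0 t)) < \<epsilon>1"
    using \<open>0 < t\<close> eps(1) unfolding continuous_on_iff by force
  define \<delta> where "\<delta> = min (min 1 t) (min (\<delta>1 / 2) (\<epsilon> / (32 * A * C)))"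
  have \<delta>: "\<delta> > 0" "\<delta> \<le> 1" "\<delta> \<le> t" "\<delta> < \<delta>1" "\<delta> \<le> \<epsilon> / (32 * A * C)"
    using \<open>\<delta>1 > 0\<close> \<open>0 < t\<close> \<open>\<epsilon> > 0\<close> \<open>A > 0\<close> \<open>C > 0\<close> by (auto simp: \<delta>_def)
  \<comment> \<open>The ramp is 0 up to \<open>t - \<delta>\<close>, 1 at \<open>t\<close> and 2 at
    \<open>t + \<delta>\<close>. It need not level off: arrival times stay within
    \<open>\<delta> / 2\<close> of \<open>t\<close>, where it is at least
    \<open>1 / 2\<close>.\<close>
  define k where "k = (\<lambda>s. max 0 ((1 - t / \<delta>) + (1 / \<delta>) * s))"
  have k_eq: "(1 - t / \<delta>) + (1 / \<delta>) * s = (s - (t - \<delta>)) / \<delta>" for s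
    using \<delta>(1) by (simp add: field_simps)
  define \<phi> where "\<phi> = (\<lambda>s. k s ^ 3)"
  define \<phi>' where "\<phi>' = (\<lambda>s. 3 * (1 / \<delta>) * k s ^ 2)"
  have \<phi>: "C2_on S \<phi> \<phi>' (\<lambda>s. 6 * (1 / \<delta>)\<^sup>2 * k s)" for S
    unfolding \<phi>_def \<phi>'_def k_def by (rule C2_on_cubic_cutoff)
  have k0: "k s \<ge> 0" for s by (simp add: k_def)
  have k1: "k s = 0" if "s \<le> t - \<delta>" for s using that \<delta>(1) by (simp add: k_def k_eq field_simps max_def)
  have k2: "k s \<le> 2" if "s \<le> t + \<delta>" for s using that \<delta>(1) by (simp add: k_def k_eq field_simps)
  have k3: "k s \<ge> 1 / 2" if "s \<ge> t - \<delta> / 2" for s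
    using that \<delta>(1) by (simp add: k_def k_eq field_simps max_def)
  \<comment> \<open>Antiderivative of the defect bound \<open>m'\<close>. The \<open>C\<close> term
    gains a factor \<delta> from the short window; the \<epsilon>1 term does not and relies on the
    continuity of \<open>Lv L\<close>.\<close>
  define m where "m = (\<lambda>s. C * \<delta> / 4 * k s ^ 4 + \<epsilon>1 * \<phi> s)"
  define m' where "m' = (\<lambda>s. C * \<phi> s + \<epsilon>1 * \<phi>' s)"
  have mD: "(m has_real_derivative m' s) (at s within S)" for s S
  proof -
    have "((\<lambda>s. k s ^ 4) has_real_derivative 4 * (1 / \<delta>) * k s ^ 3) (at s within S)"
      using DERIV_max_0_affine_power[of 4 "1 - t / \<delta>" "1 / \<delta>" s S] by (simp add: k_def)
    moreover have "(\<phi> has_real_derivative \<phi>' s) (at s within S)"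
      using DERIV_max_0_affine_power[of 3 "1 - t / \<delta>" "1 / \<delta>" s S] by (simp add: k_def \<phi>_def \<phi>'_def)
    ultimately have "(m has_real_derivative C * \<delta> / 4 * (4 * (1 / \<delta>) * k s ^ 3) + \<epsilon>1 * \<phi>' s) (at s within S)"
      unfolding m_def by (intro DERIV_add DERIV_cmult)
    also have "C * \<delta> / 4 * (4 * (1 / \<delta>) * k s ^ 3) + \<epsilon>1 * \<phi>' s = m' s"
      using \<delta>(1) by (simp add: m'_def \<phi>_def)
    finally show ?thesis .
  qed
  have m_le: "m s \<le> 3 * \<epsilon> / (8 * A)" if "s \<le> t + \<delta>" for s
  proof -
    have "k s ^ 4 \<le> 2 ^ 4" "k s ^ 3 \<le> 2 ^ 3" by (rule power_mono[OF k2[OF that] k0])+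
    then have "m s \<le> C * \<delta> / 4 * 2 ^ 4 + \<epsilon>1 * 2 ^ 3"
      unfolding m_def \<phi>_def using \<open>C > 0\<close> \<delta> eps by (intro add_mono mult_left_mono) auto
    also have "\<dots> = 4 * C * \<delta> + \<epsilon> / (8 * A)" by (simp add: \<epsilon>1_def)
    also have "4 * C * \<delta> \<le> 4 * C * (\<epsilon> / (32 * A * C))"
      using \<open>C > 0\<close> \<delta> by (intro mult_left_mono) auto
    also have "\<dots> = \<epsilon> / (8 * A)" using \<open>C > 0\<close> by simp
    finally show ?thesis using \<open>\<epsilon> > 0\<close> \<open>A > 0\<close> by (simp add: field_simps)
  qed
  have w0': "solves (t + \<delta>) g g' w0"
    by (rule solves_subset[OF w0(1)]) (use \<delta> in simp)
  define I where "I = (\<lambda>s. integral {0..s} (\<lambda>s. Lu L (z0 s)))"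
  have "\<exists>\<rho>>0. \<forall>e w s. norm e + \<bar>0\<bar> < \<rho> \<longrightarrow>
       solves (t + \<delta>) (\<lambda>s. g s + \<phi> s *\<^sub>R e) (\<lambda>s. g' s + \<phi>' s *\<^sub>R e) w \<longrightarrow>
       w 0 = u \<longrightarrow> s \<in> {0..t + \<delta>} \<longrightarrow>
       w s \<le> w0 s + \<phi> s *\<^sub>R q \<bullet> e + (m s + \<epsilon>2) * norm e * exp ((K + 1) * s)"
  proof (rule variation_bound[OF w0', of \<phi> \<phi>' "\<lambda>s. exp (I s)" "\<lambda>s. \<phi> s *\<^sub>R q" "\<lambda>s. \<phi>' s *\<^sub>R q" m m' \<epsilon>2])
    fix s assume s: "s \<in> {0..t + \<delta>}"
    then have s': "s \<in> {0..t + 1}" using \<delta> by auto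
    have "(I has_real_derivative Lu L (z0 s)) (at s within {0..t + 1})"
      unfolding I_def by (rule integral_has_real_derivative[OF continuous_on_Lu[OF z0c] s'])
    then have "(I has_real_derivative Lu L (z0 s)) (at s within {0..t + \<delta>})"
      by (rule DERIV_subset) (use \<delta> in auto)
    then show "((\<lambda>s. exp (I s)) has_real_derivative Lu L (g s, g' s, w0 s) * exp (I s)) (at s within {0..t + \<delta>})"
      by (auto intro!: derivative_eq_intros simp: z0_def)
    show "((\<lambda>s. \<phi> s *\<^sub>R q) has_vector_derivative \<phi>' s *\<^sub>R q) (at s within {0..t + \<delta>})"
      using C2_on_scaleR[OF \<phi> C2_on_const, of "{0..t + \<delta>}" q] s by (simp add: C2_on_def)
    show "0 \<le> m s" "0 \<le> m' s"
      unfolding m_def m'_def \<phi>_def \<phi>'_def using k0[of s] \<open>C > 0\<close> \<delta> eps by simp_all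
    fix e
    \<comment> \<open>The terms with \<open>\<phi>'\<close>, of size \<open>1 / \<delta>\<close>,
      cancel up to \<open>Lv L (z0 s) - q\<close>. This is at most \<epsilon>1 on the window, and
      \<open>\<phi>'\<close> vanishes before it.\<close>
    have "blinfun_apply (L' (z0 s)) (\<phi> s *\<^sub>R e, \<phi>' s *\<^sub>R e, \<phi> s *\<^sub>R q \<bullet> e) - \<phi>' s *\<^sub>R q \<bullet> e
      = \<phi> s * (blinfun_apply (L' (z0 s)) (e, 0, 0) + Lu L (z0 s) * (q \<bullet> e)) + \<phi>' s * ((Lv L (z0 s) - q) \<bullet> e)"
      using blinfun.scaleR_right[of "L' (z0 s)" "\<phi> s" "(e, 0, 0)"]
      by (subst L'_split) (simp add: algebra_simps)
    also have "\<dots> \<le> \<phi> s * (C * norm e) + \<phi>' s * (\<epsilon>1 * norm e)"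
    proof (intro add_mono)
      have "Lu L (z0 s) * (q \<bullet> e) \<le> \<bar>Lu L (z0 s)\<bar> * \<bar>q \<bullet> e\<bar>"
        by (metis abs_ge_self abs_mult)
      also have "\<dots> \<le> K * (norm q * norm e)"
        using Cauchy_Schwarz_ineq2 Lu_bound K_pos by (intro mult_mono) (auto simp: z0_def)
      finally show "\<phi> s * (blinfun_apply (L' (z0 s)) (e, 0, 0) + Lu L (z0 s) * (q \<bullet> e)) \<le> \<phi> s * (C * norm e)"
        using C1(2)[OF s', of e] k0[of s] by (intro mult_left_mono) (auto simp: C_def \<phi>_def algebra_simps)
      show "\<phi>' s * ((Lv L (z0 s) - q) \<bullet> e) \<le> \<phi>' s * (\<epsilon>1 * norm e)"
      proof (cases "s \<le> t - \<delta>")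
        case False
        then have "norm (Lv L (z0 s) - q) \<le> \<epsilon>1"
          using \<delta>1[OF s'] s \<delta> by (force simp: dist_norm q_def z0_def)
        then have "(Lv L (z0 s) - q) \<bullet> e \<le> \<epsilon>1 * norm e"
          by (rule order_trans[OF norm_cauchy_schwarz mult_right_mono[OF _ norm_ge_zero]])
        then show ?thesis using \<delta>(1) by (intro mult_left_mono) (auto simp: \<phi>'_def)
      qed (simp add: k1 \<phi>'_def)
    qed
    finally show "blinfun_apply (L' (g s, g' s, w0 s)) (\<phi> s *\<^sub>R e, \<phi>' s *\<^sub>R e, \<phi> s *\<^sub>R q \<bullet> e)
       - \<phi>' s *\<^sub>R q \<bullet> e \<le> m' s * norm e"
      by (simp add: z0_def m'_def algebra_simps)
  next
    fix \<rho> assume "0 < \<rho>" and \<rho>: "\<And>e r w s. norm e + \<bar>r\<bar> < \<rho> \<Longrightarrow>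
       solves (t + \<delta>) (\<lambda>s. g s + \<phi> s *\<^sub>R e) (\<lambda>s. g' s + \<phi>' s *\<^sub>R e) w \<Longrightarrow>
       w 0 \<le> w0 0 + \<phi> 0 *\<^sub>R q \<bullet> e + r * exp (I 0) \<Longrightarrow> s \<in> {0..t + \<delta>} \<Longrightarrow>
       w s \<le> w0 s + \<phi> s *\<^sub>R q \<bullet> e + r * exp (I s) + (m s + \<epsilon>2) * (norm e + \<bar>r\<bar>) * exp ((K + 1) * s)"
    have "\<phi> 0 = 0" using k1[of 0] \<delta> by (simp add: \<phi>_def)
    then show ?thesis using \<open>0 < \<rho>\<close> \<rho>[where r = 0] w0(2) by (intro exI[of _ \<rho>]) auto
  qed (use \<open>0 < t\<close> \<delta> eps mD in \<open>auto intro!: gc C2_on_imp_continuous_on[OF \<phi>]\<close>)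
  then obtain \<rho>1 where "\<rho>1 > 0" and \<rho>1: "\<And>e w s. norm e < \<rho>1 \<Longrightarrow>
       solves (t + \<delta>) (\<lambda>s. g s + \<phi> s *\<^sub>R e) (\<lambda>s. g' s + \<phi>' s *\<^sub>R e) w \<Longrightarrow>
       w 0 = u \<Longrightarrow> s \<in> {0..t + \<delta>} \<Longrightarrow>
       w s \<le> w0 s + \<phi> s * (q \<bullet> e) + (m s + \<epsilon>2) * norm e * exp ((K + 1) * s)"
    by auto

  \<comment> \<open>The derivative is two-sided because \<open>w0\<close> solves the equation up to
    \<open>t + 1\<close>.\<close>
  have "(w0 has_derivative (*) l) (at t)"
    using w0(1) \<open>0 < t\<close> unfolding solves_def has_field_derivative_def l_def
    by (metis at_within_Icc_at atLeastAtMost_iff less_add_one less_eq_real_def add_increasing2 zero_le_one)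
  then obtain \<rho>2 where "\<rho>2 > 0" and \<rho>2: "\<And>\<tau>. norm (\<tau> - t) < \<rho>2 \<Longrightarrow>
      norm (w0 \<tau> - w0 t - l * (\<tau> - t)) \<le> \<epsilon>3 * norm (\<tau> - t)"
    using eps(3) unfolding has_derivative_at_alt by blast
  have "(g has_derivative (\<lambda>s. s *\<^sub>R g' t)) (at t)"
    using g by (simp add: C2_on_def has_vector_derivative_def)
  then obtain \<rho>3 where "\<rho>3 > 0" and \<rho>3: "\<And>\<tau>. norm (\<tau> - t) < \<rho>3 \<Longrightarrow>
      norm (g \<tau> - g t - (\<tau> - t) *\<^sub>R g' t) \<le> \<epsilon>3 * norm (\<tau> - t)"
    using eps(3) unfolding has_derivative_at_alt by blast

  \<comment> \<open>\<open>\<delta> / 2\<close> keeps \<open>\<phi> \<tau>\<close> above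
    \<open>1 / 8\<close>; since \<open>norm e \<le> 8 * M * N\<close> and
    \<open>N < 2 * \<rho>\<close>, the second entry keeps \<open>e\<close> in the range of the
    variation bound.\<close>
  define \<rho> where "\<rho> = Min {\<delta> / 2, \<rho>1 / (16 * M), \<rho>2, \<rho>3}"
  have \<rho>: "\<rho> > 0" "\<rho> \<le> \<delta> / 2" "\<rho> \<le> \<rho>1 / (16 * M)" "\<rho> \<le> \<rho>2" "\<rho> \<le> \<rho>3"
    using \<delta> \<open>\<rho>1 > 0\<close> \<open>\<rho>2 > 0\<close> \<open>\<rho>3 > 0\<close> \<open>M \<ge> 1\<close> by (auto simp: \<rho>_def)
  show thesis
  proof
    show "0 < \<rho>" "\<rho> \<le> t" using \<rho> \<delta> by auto
    fix \<tau> z assume \<tau>: "\<bar>\<tau> - t\<bar> < \<rho>" and z: "norm (z - g t) < \<rho>"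
    define N where "N = norm (z - g t) + \<bar>\<tau> - t\<bar>"
    have N: "N \<ge> 0" "N < 2 * \<rho>" "\<bar>\<tau> - t\<bar> \<le> N" using \<tau> z by (auto simp: N_def)
    have \<tau>': "\<tau> \<in> {0..t + \<delta>}" "0 < \<tau>" "\<tau> \<ge> t - \<delta> / 2" using \<tau> \<rho> \<delta> by auto
    have \<phi>\<tau>: "\<phi> \<tau> \<ge> (1/2) ^ 3"
      unfolding \<phi>_def using k3[OF \<tau>'(3)] by (intro power_mono) auto
    then have \<phi>\<tau>0: "\<phi> \<tau> > 0" by (simp add: power_divide)
    define e where "e = (1 / \<phi> \<tau>) *\<^sub>R (z - g \<tau>)"
    have \<phi>e: "\<phi> \<tau> *\<^sub>R e = z - g \<tau>" using \<phi>\<tau>0 by (simp add: e_def)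
    have gd: "norm (g \<tau> - g t - (\<tau> - t) *\<^sub>R g' t) \<le> \<epsilon>3 * \<bar>\<tau> - t\<bar>"
      using \<rho>3[of \<tau>] \<tau> \<rho> by simp
    have "norm (z - g \<tau>) \<le> M * N"
    proof -
      define a where "a = (\<tau> - t) *\<^sub>R g' t"
      define r where "r = g \<tau> - g t - a"
      have "norm (z - g \<tau>) = norm ((z - g t) - a - r)" by (simp add: r_def)
      then have "norm (z - g \<tau>) \<le> norm (z - g t) + norm a + norm r"
        using norm_triangle_ineq4[of "(z - g t) - a" r] norm_triangle_ineq4[of "z - g t" a] by linarith
      also have "\<dots> \<le> norm (z - g t) + \<bar>\<tau> - t\<bar> * norm (g' t) + 1 * \<bar>\<tau> - t\<bar>"
        using gd mult_right_mono[OF eps(4), of "\<bar>\<tau> - t\<bar>"] by (simp add: a_def r_def)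
      also have "\<dots> = 1 * norm (z - g t) + M * \<bar>\<tau> - t\<bar>" by (simp add: M_def algebra_simps)
      also have "\<dots> \<le> M * norm (z - g t) + M * \<bar>\<tau> - t\<bar>"
        using \<open>M \<ge> 1\<close> by (intro add_right_mono mult_right_mono) auto
      finally show ?thesis by (simp add: N_def algebra_simps)
    qed
    moreover have "norm e \<le> 8 * norm (z - g \<tau>)"
    proof -
      have "1 / \<phi> \<tau> \<le> 8" using \<phi>\<tau> \<phi>\<tau>0 by (simp add: field_simps)
      then show ?thesis using \<phi>\<tau>0 by (simp add: e_def mult_right_mono flip: times_divide_eq_left)
    qed
    ultimately have e: "norm e \<le> 8 * M * N" by simp
    also have "\<dots> < 8 * M * (2 * \<rho>)" using N \<open>M \<ge> 1\<close> by (intro mult_strict_left_mono) auto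
    also have "\<dots> \<le> \<rho>1" using \<rho>(3) \<open>M \<ge> 1\<close> by (simp add: field_simps)
    finally have e_small: "norm e < \<rho>1" .
    have ge: "C2_on S (\<lambda>s. g s + \<phi> s *\<^sub>R e) (\<lambda>s. g' s + \<phi>' s *\<^sub>R e)
        (\<lambda>s. g'' s + (6 * (1 / \<delta>)\<^sup>2 * k s) *\<^sub>R e)" for S
      using C2_on_add[OF C2_on_subset[OF g subset_UNIV] C2_on_scaleR[OF \<phi> C2_on_const]] by simp
    obtain w where w: "solves (t + \<delta>) (\<lambda>s. g s + \<phi> s *\<^sub>R e) (\<lambda>s. g' s + \<phi>' s *\<^sub>R e) w" "w 0 = u"
      using solves_exists[OF C2_on_imp_continuous_on[OF ge]] \<open>0 < t\<close> \<delta>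
      by (metis add_nonneg_nonneg less_imp_le)
    have "fund_sol L \<tau> (g 0) z u \<le> w \<tau> - u"
    proof (rule fund_sol_le[OF ge \<tau>'(2) solves_subset[OF w(1)] w(2)])
      show "g 0 + \<phi> 0 *\<^sub>R e = g 0" using k1[of 0] \<delta> by (simp add: \<phi>_def)
    qed (use \<tau>' \<phi>e in auto)
    also have "w \<tau> \<le> w0 \<tau> + \<phi> \<tau> * (q \<bullet> e) + (m \<tau> + \<epsilon>2) * norm e * exp ((K + 1) * \<tau>)"
      by (rule \<rho>1[OF e_small w \<tau>'(1)])
    also have "\<phi> \<tau> * (q \<bullet> e) = q \<bullet> (z - g \<tau>)" by (metis \<phi>e inner_scaleR_right)
    also have "q \<bullet> (z - g \<tau>) \<le> q \<bullet> (z - g t) - (q \<bullet> g' t) * (\<tau> - t) + norm q * (\<epsilon>3 * \<bar>\<tau> - t\<bar>)"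
    proof -
      have "- (q \<bullet> (g \<tau> - g t - (\<tau> - t) *\<^sub>R g' t)) \<le> norm q * norm (g \<tau> - g t - (\<tau> - t) *\<^sub>R g' t)"
        using Cauchy_Schwarz_ineq2[of q "g \<tau> - g t - (\<tau> - t) *\<^sub>R g' t"] by linarith
      also have "\<dots> \<le> norm q * (\<epsilon>3 * \<bar>\<tau> - t\<bar>)" by (intro mult_left_mono gd) auto
      finally show ?thesis by (simp add: algebra_simps)
    qed
    also have "w0 \<tau> \<le> w0 t + l * (\<tau> - t) + \<epsilon>3 * \<bar>\<tau> - t\<bar>"
      using \<rho>2[of \<tau>] \<tau> \<rho> by (simp add: abs_le_iff)
    also have "(m \<tau> + \<epsilon>2) * norm e * exp ((K + 1) * \<tau>) \<le> (\<epsilon> / (2 * A)) * (8 * M * N) * exp ((K + 1) * (t + 1))"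
    proof (intro mult_mono)
      show "m \<tau> + \<epsilon>2 \<le> \<epsilon> / (2 * A)"
        using m_le[of \<tau>] \<tau>' \<open>A > 0\<close> by (simp add: \<epsilon>2_def field_simps)
      show "exp ((K + 1) * \<tau>) \<le> exp ((K + 1) * (t + 1))" using \<tau>' \<delta> K_pos by simp
    qed (use e N \<open>M \<ge> 1\<close> \<open>A > 0\<close> \<open>\<epsilon> > 0\<close> in auto)
    also have "\<dots> = \<epsilon> / 2 * N"
    proof -
      have "(\<epsilon> / (2 * A)) * (8 * M * N) * exp ((K + 1) * (t + 1)) = (\<epsilon> / (2 * A)) * A * N"
        by (simp add: A_def)
      then show ?thesis using \<open>A > 0\<close> by simp
    qed
    finally have "fund_sol L \<tau> (g 0) z u \<le> w0 t - u + q \<bullet> (z - g t) + (l - q \<bullet> g' t) * (\<tau> - t)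
        + (\<epsilon>3 * (1 + norm q) * \<bar>\<tau> - t\<bar> + \<epsilon> / 2 * N)"
      by (simp add: algebra_simps)
    also have "\<epsilon>3 * (1 + norm q) * \<bar>\<tau> - t\<bar> \<le> \<epsilon> / 8 * N"
    proof (intro mult_mono N(3))
      have "\<epsilon>3 * (1 + norm q) \<le> \<epsilon> / (8 * (1 + norm q)) * (1 + norm q)"
        using nq by (intro mult_right_mono) (auto simp: \<epsilon>3_def)
      also have "\<dots> = \<epsilon> / 8" using nq by (simp add: field_simps)
      finally show "\<epsilon>3 * (1 + norm q) \<le> \<epsilon> / 8" .
    qed (use \<open>\<epsilon> > 0\<close> in auto)
    also have "\<epsilon> / 8 * N + \<epsilon> / 2 * N \<le> \<epsilon> * N" using N(1) \<open>\<epsilon> > 0\<close> by simp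
    finally show "fund_sol L \<tau> (g 0) z u \<le> w0 t - u + q \<bullet> (z - g t) + (l - q \<bullet> g' t) * (\<tau> - t)
        + \<epsilon> * (norm (z - g t) + \<bar>\<tau> - t\<bar>)" by (simp add: N_def)
  qed
qed

text \<open>Starting at distance \<open>e\<close> and returning to \<open>g\<close> within time
  \<delta> changes the solution by about \<open>- (q \<bullet> e)\<close>, the sign being that of
  the decreasing cut-off. From then on the linearized equation transports this change, whence the
  factor \<open>J t\<close>.\<close>

lemma fund_sol_start_supports:
  assumes g: "C2_on {0..t} g g' g''" and "0 < t"
    and w0: "solves t g g' w0" "w0 0 = u"
    and J: "\<And>s. s \<in> {0..t} \<Longrightarrow> (J has_real_derivative Lu L (g s, g' s, w0 s) * J s) (at s within {0..t})"
      "J 0 = 1"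
    and eq: "fund_sol L t (g 0) (g t) u = w0 t - u"
  shows "supports_above (\<lambda>z. fund_sol L t z (g t) u) (g 0) (- J t *\<^sub>R Lv L (g 0, g' 0, w0 0))"
  unfolding supports_above_def
proof (intro allI impI)
  fix \<epsilon> :: real assume "\<epsilon> > 0"
  define q where "q = Lv L (g 0, g' 0, w0 0)"
  define z0 where "z0 = (\<lambda>s. (g s, g' s, w0 s))"
  note gc = C2_on_imp_continuous_on[OF g]
  have z0c: "continuous_on {0..t} z0"
    unfolding z0_def by (intro continuous_intros gc solves_continuous_on[OF w0(1)])
  have Jc: "continuous_on {0..t} J" by (rule DERIV_continuous_on[OF J(1)])
  obtain C where C: "0 < C" "\<And>s e. s \<in> {0..t} \<Longrightarrow> blinfun_apply (L' (z0 s)) (e, 0, 0) \<le> C * norm e"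
    using L'_position_bound[OF z0c] by metis
  define A where "A = exp ((K + 1) * t)"
  have "A > 0" by (simp add: A_def)
  define \<epsilon>1 where "\<epsilon>1 = \<epsilon> / (4 * A)"
  have "\<epsilon>1 > 0" using \<open>\<epsilon> > 0\<close> \<open>A > 0\<close> by (simp add: \<epsilon>1_def)
  have "continuous_on {0..t} (\<lambda>s. Lv L (z0 s) - J s *\<^sub>R q)" by (intro continuous_intros z0c Jc)
  then obtain \<delta>1 where "\<delta>1 > 0" and \<delta>1: "\<And>s. s \<in> {0..t} \<Longrightarrow> dist s 0 < \<delta>1 \<Longrightarrow>
      dist (Lv L (z0 s) - J s *\<^sub>R q) (Lv L (z0 0) - J 0 *\<^sub>R q) < \<epsilon>1"
    using \<open>0 < t\<close> \<open>\<epsilon>1 > 0\<close> unfolding continuous_on_iff by force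
  define \<delta> where "\<delta> = min t (min (\<delta>1 / 2) (\<epsilon>1 / C))"
  have "\<delta> \<le> \<epsilon>1 / C" "\<delta> \<le> \<delta>1 / 2" unfolding \<delta>_def by linarith+
  then have \<delta>: "\<delta> > 0" "\<delta> \<le> t" "\<delta> < \<delta>1" "C * \<delta> \<le> \<epsilon>1"
    using \<open>\<delta>1 > 0\<close> \<open>0 < t\<close> \<open>\<epsilon>1 > 0\<close> C(1) by (auto simp: \<delta>_def pos_le_divide_eq mult.commute)
  define k where "k = (\<lambda>s. max 0 (1 + (- 1 / \<delta>) * s))"
  define \<phi> where "\<phi> = (\<lambda>s. k s ^ 3)"
  define \<phi>' where "\<phi>' = (\<lambda>s. 3 * (- 1 / \<delta>) * k s ^ 2)"
  have \<phi>: "C2_on S \<phi> \<phi>' (\<lambda>s. 6 * (- 1 / \<delta>)\<^sup>2 * k s)" for S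
    unfolding \<phi>_def \<phi>'_def k_def by (rule C2_on_cubic_cutoff)
  have \<phi>D: "(\<phi> has_real_derivative \<phi>' s) (at s within S)" for s S
    using DERIV_max_0_affine_power[of 3 1 "- 1 / \<delta>" s S] by (simp add: k_def \<phi>_def \<phi>'_def)
  have k0: "k s \<ge> 0" for s by (simp add: k_def)
  have k1: "k s = 0" if "s \<ge> \<delta>" for s using that \<delta>(1) by (simp add: k_def max_def field_simps)
  have k2: "k s \<le> 1" if "s \<ge> 0" for s using that \<delta>(1) by (simp add: k_def)
  have k3: "k 0 = 1" by (simp add: k_def)
  define m where "m = (\<lambda>s. C * \<delta> / 4 * (1 - k s ^ 4) + \<epsilon>1 * (1 - \<phi> s))"
  define m' where "m' = (\<lambda>s. C * \<phi> s + \<epsilon>1 * (- \<phi>' s))"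
  have mD: "(m has_real_derivative m' s) (at s within S)" for s S
  proof -
    have "((\<lambda>s. k s ^ 4) has_real_derivative 4 * (- 1 / \<delta>) * k s ^ 3) (at s within S)"
      using DERIV_max_0_affine_power[of 4 1 "- 1 / \<delta>" s S] by (simp add: k_def)
    then have "(m has_real_derivative C * \<delta> / 4 * (0 - 4 * (- 1 / \<delta>) * k s ^ 3) + \<epsilon>1 * (0 - \<phi>' s)) (at s within S)"
      unfolding m_def by (intro DERIV_add DERIV_cmult DERIV_diff DERIV_const \<phi>D)
    also have "C * \<delta> / 4 * (0 - 4 * (- 1 / \<delta>) * k s ^ 3) + \<epsilon>1 * (0 - \<phi>' s) = m' s"
      using \<delta>(1) by (simp add: m'_def \<phi>_def)
    finally show ?thesis .
  qed
  have m_nonneg: "0 \<le> m s" if "0 \<le> s" for s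
    using power_le_one[OF k0 k2[OF that]] C(1) \<delta>(1) \<open>\<epsilon>1 > 0\<close> by (simp add: m_def \<phi>_def)
  have m'_nonneg: "0 \<le> m' s" for s
    using k0[of s] C(1) \<delta>(1) \<open>\<epsilon>1 > 0\<close> by (simp add: m'_def \<phi>_def \<phi>'_def)
  \<comment> \<open>This \<open>P\<close> vanishes at 0, where the value \<open>u\<close> is kept,
    and equals \<open>- J t *\<^sub>R q\<close> at \<open>t\<close>. The factor \<open>J\<close>
    makes the \<open>Lu L\<close> terms of the defect cancel exactly; besides the position term only
    \<open>\<phi>'\<close> times \<open>Lv L (z0 s) - J s *\<^sub>R q\<close> remains, which is
    small near 0 as \<open>J 0 = 1\<close>.\<close>
  have PD: "((\<lambda>s. ((\<phi> s - 1) * J s) *\<^sub>R q) has_vector_derivative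
      ((\<phi> s - 1) * (Lu L (z0 s) * J s) + \<phi>' s * J s) *\<^sub>R q) (at s within {0..t})" if "s \<in> {0..t}" for s
  proof -
    have "((\<lambda>s. (\<phi> s - 1) * J s) has_real_derivative
        (\<phi>' s - 0) * J s + (Lu L (z0 s) * J s) * (\<phi> s - 1)) (at s within {0..t})"
      unfolding z0_def by (intro DERIV_mult DERIV_diff \<phi>D DERIV_const J(1) that)
    from has_vector_derivative_scaleR[OF this has_vector_derivative_const[of q]] show ?thesis
      by (simp add: algebra_simps)
  qed
  have defect: "blinfun_apply (L' (g s, g' s, w0 s)) (\<phi> s *\<^sub>R e, \<phi>' s *\<^sub>R e, ((\<phi> s - 1) * J s) *\<^sub>R q \<bullet> e)
     - ((\<phi> s - 1) * (Lu L (z0 s) * J s) + \<phi>' s * J s) *\<^sub>R q \<bullet> e \<le> m' s * norm e"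
    if s: "s \<in> {0..t}" for s e
  proof -
    have "blinfun_apply (L' (z0 s)) (\<phi> s *\<^sub>R e, \<phi>' s *\<^sub>R e, ((\<phi> s - 1) * J s) *\<^sub>R q \<bullet> e)
       - ((\<phi> s - 1) * (Lu L (z0 s) * J s) + \<phi>' s * J s) *\<^sub>R q \<bullet> e
      = \<phi> s * blinfun_apply (L' (z0 s)) (e, 0, 0) + (- \<phi>' s) * ((J s *\<^sub>R q - Lv L (z0 s)) \<bullet> e)"
      using blinfun.scaleR_right[of "L' (z0 s)" "\<phi> s" "(e, 0, 0)"]
      by (subst L'_split) (simp add: algebra_simps)
    also have "\<dots> \<le> \<phi> s * (C * norm e) + (- \<phi>' s) * (\<epsilon>1 * norm e)"
    proof (intro add_mono)
      show "\<phi> s * blinfun_apply (L' (z0 s)) (e, 0, 0) \<le> \<phi> s * (C * norm e)"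
        using C(2)[OF s, of e] k0[of s] by (intro mult_left_mono) (auto simp: \<phi>_def)
      show "(- \<phi>' s) * ((J s *\<^sub>R q - Lv L (z0 s)) \<bullet> e) \<le> (- \<phi>' s) * (\<epsilon>1 * norm e)"
      proof (cases "s \<ge> \<delta>")
        case False
        then have "norm (J s *\<^sub>R q - Lv L (z0 s)) \<le> \<epsilon>1"
          using \<delta>1[OF s] s \<delta> by (simp add: dist_norm q_def z0_def J norm_minus_commute)
        then have "(J s *\<^sub>R q - Lv L (z0 s)) \<bullet> e \<le> \<epsilon>1 * norm e"
          by (rule order_trans[OF norm_cauchy_schwarz mult_right_mono[OF _ norm_ge_zero]])
        then show ?thesis using \<delta>(1) by (intro mult_left_mono) (auto simp: \<phi>'_def)
      qed (simp add: k1 \<phi>'_def)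
    qed
    finally show ?thesis by (simp add: z0_def m'_def algebra_simps)
  qed
  obtain \<rho> where "\<rho> > 0" and \<rho>: "\<And>e r w s. norm e + \<bar>r\<bar> < \<rho> \<Longrightarrow>
       solves t (\<lambda>s. g s + \<phi> s *\<^sub>R e) (\<lambda>s. g' s + \<phi>' s *\<^sub>R e) w \<Longrightarrow>
       w 0 \<le> w0 0 + ((\<phi> 0 - 1) * J 0) *\<^sub>R q \<bullet> e + r * J 0 \<Longrightarrow> s \<in> {0..t} \<Longrightarrow>
       w s \<le> w0 s + ((\<phi> s - 1) * J s) *\<^sub>R q \<bullet> e + r * J s + (m s + \<epsilon>1) * (norm e + \<bar>r\<bar>) * exp ((K + 1) * s)"
    by (rule variation_bound[OF w0(1) less_imp_le[OF \<open>0 < t\<close>] gc C2_on_imp_continuous_on[OF \<phi>] J(1)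
          PD mD m_nonneg m'_nonneg defect \<open>\<epsilon>1 > 0\<close>]) auto
  have "fund_sol L t z (g t) u \<le> fund_sol L t (g 0) (g t) u + (- J t *\<^sub>R q) \<bullet> (z - g 0) + \<epsilon> * norm (z - g 0)"
    if z: "norm (z - g 0) < \<rho>" for z
  proof -
    define e where "e = z - g 0"
    have ge: "C2_on {0..t} (\<lambda>s. g s + \<phi> s *\<^sub>R e) (\<lambda>s. g' s + \<phi>' s *\<^sub>R e)
        (\<lambda>s. g'' s + (6 * (- 1 / \<delta>)\<^sup>2 * k s) *\<^sub>R e)"
      using C2_on_add[OF g C2_on_scaleR[OF \<phi> C2_on_const]] by simp
    obtain w where w: "solves t (\<lambda>s. g s + \<phi> s *\<^sub>R e) (\<lambda>s. g' s + \<phi>' s *\<^sub>R e) w" "w 0 = u"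
      using solves_exists[OF C2_on_imp_continuous_on[OF ge]] \<open>0 < t\<close> by (metis less_imp_le)
    have \<phi>01: "\<phi> 0 = 1" "\<phi> t = 0" using k1[of t] k3 \<delta> by (auto simp: \<phi>_def)
    have "fund_sol L t z (g t) u \<le> w t - u"
      by (rule fund_sol_le[OF ge \<open>0 < t\<close> w]) (simp_all add: \<phi>01 e_def)
    also have "w t \<le> w0 t - J t * (q \<bullet> e) + (m t + \<epsilon>1) * norm e * A"
      using \<rho>[of e 0 w t] z w w0(2) \<open>0 < t\<close> by (simp add: \<phi>01 e_def A_def)
    also have "(m t + \<epsilon>1) * norm e * A \<le> \<epsilon> * norm e"
    proof -
      have "m t + \<epsilon>1 \<le> 4 * \<epsilon>1"
        using \<delta>(4) \<open>\<epsilon>1 > 0\<close> k1[OF \<delta>(2)] by (simp add: m_def \<phi>01)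
      then have "(m t + \<epsilon>1) * (norm e * A) \<le> (4 * \<epsilon>1) * (norm e * A)"
        using \<open>A > 0\<close> by (intro mult_right_mono) auto
      also have "\<dots> = \<epsilon> * norm e" using \<open>A > 0\<close> by (simp add: \<epsilon>1_def)
      finally show ?thesis by (simp add: mult_ac)
    qed
    finally show ?thesis by (simp add: eq e_def)
  qed
  with \<open>\<rho> > 0\<close> show "\<exists>\<rho>>0. \<forall>z. norm (z - g 0) < \<rho> \<longrightarrow> fund_sol L t z (g t) u
      \<le> fund_sol L t (g 0) (g t) u + (- J t *\<^sub>R Lv L (g 0, g' 0, w0 0)) \<bullet> (z - g 0) + \<epsilon> * norm (z - g 0)"
    unfolding q_def by blast
qed

text \<open>The curve is kept and only the initial value moves, so the final value moves at rate
  \<open>J t\<close>; the 1 comes from the subtracted initial value.\<close>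

lemma fund_sol_initial_supports:
  assumes g: "C2_on {0..t} g g' g''" and "0 < t"
    and w0: "solves t g g' w0" "w0 0 = u"
    and J: "\<And>s. s \<in> {0..t} \<Longrightarrow> (J has_real_derivative Lu L (g s, g' s, w0 s) * J s) (at s within {0..t})"
      "J 0 = 1"
    and eq: "fund_sol L t (g 0) (g t) u = w0 t - u"
  shows "supports_above (\<lambda>r. fund_sol L t (g 0) (g t) r) u (J t - 1)"
  unfolding supports_above_def
proof (intro allI impI)
  fix \<epsilon> :: real assume "\<epsilon> > 0"
  define A where "A = exp ((K + 1) * t)"
  have "A > 0" by (simp add: A_def)
  then have "\<epsilon> / A > 0" using \<open>\<epsilon> > 0\<close> by simp
  have "\<exists>\<rho>>0. \<forall>r w. \<bar>r\<bar> < \<rho> \<longrightarrow> solves t g g' w \<longrightarrow> w 0 = u + r \<longrightarrow>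
      w t \<le> w0 t + r * J t + \<epsilon> / A * \<bar>r\<bar> * exp ((K + 1) * t)"
  proof (rule variation_bound[OF w0(1) less_imp_le[OF \<open>0 < t\<close>] C2_on_imp_continuous_on[OF g], of "\<lambda>_. 0" "\<lambda>_. 0"
        J "\<lambda>_. 0" "\<lambda>_. 0" "\<lambda>_. 0" "\<lambda>_. 0" "\<epsilon> / A"])
    fix \<rho> assume "\<rho> > 0" and \<rho>: "\<And>e r w s. norm e + \<bar>r\<bar> < \<rho> \<Longrightarrow>
        solves t (\<lambda>s. g s + 0 *\<^sub>R e) (\<lambda>s. g' s + 0 *\<^sub>R e) w \<Longrightarrow>
        w 0 \<le> w0 0 + 0 \<bullet> e + r * J 0 \<Longrightarrow> s \<in> {0..t} \<Longrightarrow>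
        w s \<le> w0 s + 0 \<bullet> e + r * J s + (0 + \<epsilon> / A) * (norm e + \<bar>r\<bar>) * exp ((K + 1) * s)"
    show ?thesis
      using \<open>\<rho> > 0\<close> \<rho>[of 0 _ _ t] w0(2) J(2) \<open>0 < t\<close> by (intro exI[of _ \<rho>]) auto
  qed (use J \<open>\<epsilon> / A > 0\<close> in \<open>auto simp: blinfun.zero_right simp flip: zero_prod_def\<close>)
  then obtain \<rho> where "\<rho> > 0" and \<rho>: "\<And>r w. \<bar>r\<bar> < \<rho> \<Longrightarrow> solves t g g' w \<Longrightarrow> w 0 = u + r \<Longrightarrow>
      w t \<le> w0 t + r * J t + \<epsilon> / A * \<bar>r\<bar> * exp ((K + 1) * t)" by blast
  have "fund_sol L t (g 0) (g t) v \<le> fund_sol L t (g 0) (g t) u + (J t - 1) \<bullet> (v - u) + \<epsilon> * norm (v - u)"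
    if v: "norm (v - u) < \<rho>" for v
  proof -
    obtain w where w: "solves t g g' w" "w 0 = v"
      using solves_exists[OF C2_on_imp_continuous_on[OF g]] \<open>0 < t\<close> by (metis less_imp_le)
    have "fund_sol L t (g 0) (g t) v \<le> w t - v"
      by (rule fund_sol_le[OF g \<open>0 < t\<close> w]) simp_all
    also have "w t \<le> w0 t + (v - u) * J t + \<epsilon> * \<bar>v - u\<bar>"
      using \<rho>[of "v - u" w] v w \<open>A > 0\<close> by (simp add: A_def)
    finally show ?thesis by (simp add: eq algebra_simps)
  qed
  with \<open>\<rho> > 0\<close> show "\<exists>\<rho>>0. \<forall>v. norm (v - u) < \<rho> \<longrightarrow> fund_sol L t (g 0) (g t) v
      \<le> fund_sol L t (g 0) (g t) u + (J t - 1) \<bullet> (v - u) + \<epsilon> * norm (v - u)"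
    by blast
qed

section \<open>Restriction of minimizers\<close>

text \<open>The junction of a better curve with the rest of the minimizer has a corner. It is rounded
  off on \<open>[t, t + \<delta>]\<close> by adding to the minimizer a cut-off quadratic that matches the
  2-jet of the better curve; its 1-jet stays bounded as \<open>\<delta> \<rightarrow> 0\<close>, so the cost of the
  correction vanishes while the gain at time \<open>t\<close> does not.\<close>

lemma fund_sol_restrict:
  assumes g: "C2_on UNIV g g' g''" and t: "0 < t" "t \<le> T"
    and w0: "solves T g g' w0" "w0 0 = u"
    and eq: "fund_sol L T (g 0) (g T) u = w0 T - u"
  shows "fund_sol L t (g 0) (g t) u = w0 t - u"
proof (cases "t = T")
  case False
  then have "t < T" using t by simp
  have gS: "C2_on S g g' g''" for S by (rule C2_on_subset[OF g]) simp
  note gc = C2_on_imp_continuous_on[OF g]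
  show ?thesis
  proof (rule antisym)
    show "fund_sol L t (g 0) (g t) u \<le> w0 t - u"
      by (rule fund_sol_le[OF gS t(1) solves_subset[OF w0(1) t(2)] w0(2)]) simp_all
    show "w0 t - u \<le> fund_sol L t (g 0) (g t) u"
    proof (rule fund_sol_ge[OF _ t(1)])
      have "g \<in> curves t (g 0) (g t)"
        using gS by (auto simp: curves_def C2_curve_iff_C2_on)
      then show "curves t (g 0) (g t) \<noteq> {}" by blast
      fix f0 f0' f0'' v
      assume f0: "C2_on {0..t} f0 f0' f0''" "f0 0 = g 0" "f0 t = g t"
        and v0: "solves t f0 f0' v" "v 0 = u"
      obtain f f' f'' where f: "C2_on UNIV f f' f''"
        and f_eq: "\<And>s. s \<in> {0..t} \<Longrightarrow> f s = f0 s" "\<And>s. s \<in> {0..t} \<Longrightarrow> f' s = f0' s"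
        using C2_on_extend[OF f0(1)] t by (metis less_imp_le)
      have v: "solves t f f' v" by (rule solves_cong[OF v0(1)]) (simp add: f_eq)
      have "w0 t \<le> v t"
      proof (rule ccontr)
        assume "\<not> w0 t \<le> v t"
        then have gap: "v t < w0 t" by simp
        define a where "a = f' t - g' t"
        define b where "b = f'' t - g'' t"
        \<comment> \<open>\<open>a\<close> and \<open>b\<close> are the jumps of velocity and
          acceleration. In the derivative of the correction, \<open>k ^ 3\<close> times
          \<open>h'\<close> contributes \<open>7 * norm a + norm b\<close>, and the derivative of
          \<open>k ^ 3\<close> times \<open>h\<close> contributes
          \<open>12 * norm a + 3 * norm b\<close>.\<close>
        define B where "B = 19 * norm a + 4 * norm b"
        obtain Bg where Bg: "\<And>s. s \<in> {0..T} \<Longrightarrow> norm (g s) \<le> Bg"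
          using bounded_on_Icc[OF continuous_on_subset[OF gc(1) subset_UNIV]] by metis
        obtain Bg' where Bg': "\<And>s. s \<in> {0..T} \<Longrightarrow> norm (g' s) \<le> Bg'"
          using bounded_on_Icc[OF continuous_on_subset[OF gc(2) subset_UNIV]] by metis
        \<comment> \<open>Contains the rounded curve, its velocity and the line
          \<open>v t + \<Lambda> * (s - t)\<close> used as supersolution. It is fixed before
          \<delta>, so \<Lambda> does not depend on \<delta>.\<close>
        define R where "R = \<bar>Bg\<bar> + \<bar>Bg'\<bar> + B + \<bar>v t\<bar> + 1"
        have "compact ((\<lambda>z. L z) ` (cball 0 R \<times> cball 0 R \<times> cball 0 R))"
          by (intro compact_continuous_image continuous_intros compact_Times compact_cball)
        then obtain \<Lambda>0 where \<Lambda>0: "\<forall>z \<in> cball 0 R \<times> cball 0 R \<times> cball 0 R. \<bar>L z\<bar> \<le> \<Lambda>0"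
          using compact_imp_bounded by (fastforce simp: bounded_iff)
        define \<Lambda> where "\<Lambda> = \<bar>\<Lambda>0\<bar> + 1"
        have "\<Lambda> > 0" by (simp add: \<Lambda>_def)
        have "continuous_on {0..T} w0" by (rule solves_continuous_on[OF w0(1)])
        then obtain \<sigma> where "\<sigma> > 0" and \<sigma>: "\<And>s. s \<in> {0..T} \<Longrightarrow> dist s t < \<sigma> \<Longrightarrow> dist (w0 s) (w0 t) < (w0 t - v t) / 2"
          using t gap unfolding continuous_on_iff by (metis atLeastAtMost_iff diff_gt_0_iff_gt half_gt_zero less_imp_le)
        \<comment> \<open>\<open>1 / \<Lambda>\<close> keeps the line within radius
          \<open>R\<close>. By the last two entries the new solution rises by at most half the gap
          while \<open>w0\<close> falls by less than half.\<close>
        define \<delta> where "\<delta> = Min {1, T - t, 1 / \<Lambda>, (w0 t - v t) / (2 * \<Lambda>), \<sigma> / 2}"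
        have \<delta>: "\<delta> > 0" "\<delta> \<le> 1" "t + \<delta> \<le> T" "\<Lambda> * \<delta> \<le> 1" "\<Lambda> * \<delta> \<le> (w0 t - v t) / 2" "\<delta> < \<sigma>"
        proof -
          show "\<delta> > 0" using \<open>t < T\<close> gap \<open>\<Lambda> > 0\<close> \<open>\<sigma> > 0\<close> by (simp add: \<delta>_def)
          have "\<delta> \<le> 1" "\<delta> \<le> T - t" "\<delta> \<le> 1 / \<Lambda>" "\<delta> \<le> (w0 t - v t) / (2 * \<Lambda>)" "\<delta> \<le> \<sigma> / 2"
            unfolding \<delta>_def by (rule Min_le; simp)+
          then show "\<delta> \<le> 1" "t + \<delta> \<le> T" "\<Lambda> * \<delta> \<le> 1" "\<Lambda> * \<delta> \<le> (w0 t - v t) / 2" "\<delta> < \<sigma>"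
            using \<open>\<Lambda> > 0\<close> \<open>\<sigma> > 0\<close> by (auto simp: field_simps)
        qed
        \<comment> \<open>At \<open>t\<close> the second derivative of
          \<open>k s ^ 3 *\<^sub>R h s\<close> is \<open>c - (6 / \<delta>) *\<^sub>R a\<close>, and
          this choice makes it \<open>b\<close>. Although \<open>c\<close> is of order
          \<open>1 / \<delta>\<close>, it enters \<open>h'\<close> only with the factor
          \<open>s - t\<close>, which is at most \<delta>.\<close>
        define c where "c = b + (6 / \<delta>) *\<^sub>R a"
        define h where "h = (\<lambda>s. 0 + (s - t) *\<^sub>R a + ((s - t)\<^sup>2 / 2) *\<^sub>R c)"
        define h' where "h' = (\<lambda>s. a + (s - t) *\<^sub>R c)"
        define k where "k = (\<lambda>s. max 0 ((1 + t / \<delta>) + (- 1 / \<delta>) * s))"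
        define G where "G = (\<lambda>s. g s + k s ^ 3 *\<^sub>R h s)"
        define G' where "G' = (\<lambda>s. g' s + (k s ^ 3 *\<^sub>R h' s + (3 * (- 1 / \<delta>) * k s ^ 2) *\<^sub>R h s))"
        define G'' where "G'' = (\<lambda>s. g'' s + (k s ^ 3 *\<^sub>R c + 2 *\<^sub>R (3 * (- 1 / \<delta>) * k s ^ 2) *\<^sub>R h' s
            + (6 * (- 1 / \<delta>)\<^sup>2 * k s) *\<^sub>R h s))"
        have G: "C2_on {t..} G G' G''"
          unfolding G_def G'_def G''_def k_def h_def h'_def
          by (intro C2_on_add gS C2_on_scaleR C2_on_cubic_cutoff C2_on_quadratic)
        have k_t: "k t = 1" using \<delta>(1) by (simp add: k_def)
        have k_0: "k s = 0" if "t + \<delta> \<le> s" for s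
        proof -
          have "(1 + t / \<delta>) + (- 1 / \<delta>) * s = (t + \<delta> - s) / \<delta>" using \<delta>(1) by (simp add: field_simps)
          also have "\<dots> \<le> 0" using that \<delta>(1) by (intro divide_nonpos_pos) auto
          finally show ?thesis by (simp add: k_def)
        qed
        have k_le: "0 \<le> k s" "k s \<le> 1" if "t \<le> s" for s
          using that \<delta>(1) by (auto simp: k_def field_simps)
        have h_t: "h t = 0" "h' t = a" by (simp_all add: h_def h'_def)
        have ft: "f t = g t" using f_eq(1)[of t] f0 t by simp
        define \<zeta> where "\<zeta> = (\<lambda>s. if s \<in> {..t} then f s else G s)"
        define \<zeta>' where "\<zeta>' = (\<lambda>s. if s \<in> {..t} then f' s else G' s)"
        define \<zeta>'' where "\<zeta>'' = (\<lambda>s. if s \<in> {..t} then f'' s else G'' s)"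
        have G_t: "G t = f t" "G' t = f' t"
          by (simp_all add: G_def G'_def h_t k_t ft a_def)
        have G''_t: "G'' t = f'' t"
        proof -
          have "2 *\<^sub>R (3 * (- 1 / \<delta>)) *\<^sub>R a = - ((6 / \<delta>) *\<^sub>R a)" by simp
          then show ?thesis by (simp add: G''_def h_t k_t c_def b_def)
        qed
        have "C2_on ({..t} \<union> {t..}) \<zeta> \<zeta>' \<zeta>''"
          unfolding \<zeta>_def \<zeta>'_def \<zeta>''_def
          by (rule C2_on_glue[OF C2_on_subset[OF f subset_UNIV] G]) (auto simp: G_t G''_t)
        then have \<zeta>: "C2_on S \<zeta> \<zeta>' \<zeta>''" for S by (rule C2_on_subset) auto
        obtain w where w: "solves T \<zeta> \<zeta>' w" "w 0 = u"
          using solves_exists[OF C2_on_imp_continuous_on[OF \<zeta>]] t by (metis less_imp_le order_trans)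
        have wt: "w t = v t"
        proof (rule solves_unique[of t f f' w v])
          show "solves t f f' w"
            by (rule solves_cong[OF solves_subset[OF w(1) t(2)]]) (simp add: \<zeta>_def \<zeta>'_def)
        qed (use v v0 w t in auto)
        have small: "norm (\<zeta> s) \<le> R" "norm (\<zeta>' s) \<le> R" if s: "s \<in> {t..t+\<delta>}" for s
        proof -
          define r where "r = s - t"
          have r: "0 \<le> r" "r \<le> \<delta>" using s by (auto simp: r_def)
          have \<zeta>G: "\<zeta> s = G s" "\<zeta>' s = G' s"
            using s G_t by (cases "s = t"; simp add: \<zeta>_def \<zeta>'_def)+
          have "\<delta> * norm c \<le> norm b + 6 * norm a"
          proof -
            have "norm (\<delta> *\<^sub>R c) \<le> norm (\<delta> *\<^sub>R b) + norm (6 *\<^sub>R a)"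
              using norm_triangle_ineq[of "\<delta> *\<^sub>R b" "6 *\<^sub>R a"] \<delta>(1) by (simp add: c_def scaleR_add_right)
            moreover have "\<delta> * norm b \<le> 1 * norm b" using \<delta> by (intro mult_right_mono) auto
            ultimately show ?thesis using \<delta>(1) by simp
          qed
          moreover have "r * norm c \<le> \<delta> * norm c" using r by (intro mult_right_mono) auto
          ultimately have rc: "r * norm c \<le> norm b + 6 * norm a" by simp
          have ra: "r * norm a \<le> \<delta> * norm a" using r by (intro mult_right_mono) auto
          have h'b: "norm (h' s) \<le> 7 * norm a + norm b"
            using norm_triangle_ineq[of a "r *\<^sub>R c"] rc r by (simp add: h'_def r_def)
          have hb: "norm (h s) \<le> \<delta> * (4 * norm a + norm b)"
          proof -
            have "norm (h s) \<le> r * norm a + r / 2 * (r * norm c)"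
              using norm_triangle_ineq[of "r *\<^sub>R a" "(r\<^sup>2 / 2) *\<^sub>R c"] r
              by (simp add: h_def r_def power2_eq_square)
            also have "r / 2 * (r * norm c) \<le> \<delta> / 2 * (norm b + 6 * norm a)"
              using r rc by (intro mult_mono) auto
            finally have "norm (h s) \<le> \<delta> * norm a + \<delta> / 2 * (norm b + 6 * norm a)" using ra by simp
            also have "\<dots> \<le> \<delta> * (4 * norm a + norm b)" using \<delta>(1) by (simp add: algebra_simps)
            finally show ?thesis .
          qed
          have k: "0 \<le> k s" "k s \<le> 1" using k_le[of s] s by auto
          have k3: "0 \<le> k s ^ 3" "k s ^ 3 \<le> 1" "0 \<le> k s ^ 2" "k s ^ 2 \<le> 1"
            using k by (auto simp: power_le_one)
          have "norm (k s ^ 3 *\<^sub>R h s) \<le> 1 * norm (h s)"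
            using k3 by (simp add: mult_left_le_one_le)
          also have "\<dots> \<le> 1 * (4 * norm a + norm b)"
            using order_trans[OF hb mult_right_mono[OF \<delta>(2)]] by simp
          also have "\<dots> \<le> B" by (simp add: B_def)
          finally have 1: "norm (k s ^ 3 *\<^sub>R h s) \<le> B" .
          have "norm ((3 * (- 1 / \<delta>) * k s ^ 2) *\<^sub>R h s) = k s ^ 2 * (3 / \<delta> * norm (h s))"
            using \<delta>(1) by (simp add: abs_mult)
          also have "\<dots> \<le> 1 * (3 / \<delta> * (\<delta> * (4 * norm a + norm b)))"
            using k3 hb \<delta>(1) by (intro mult_mono mult_left_mono) auto
          also have "\<dots> = 12 * norm a + 3 * norm b" using \<delta>(1) by simp
          finally have 2: "norm ((3 * (- 1 / \<delta>) * k s ^ 2) *\<^sub>R h s) \<le> 12 * norm a + 3 * norm b" .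
          have "norm (k s ^ 3 *\<^sub>R h' s) \<le> 1 * norm (h' s)"
            using k3 by (simp add: mult_left_le_one_le)
          then have 3: "norm (k s ^ 3 *\<^sub>R h' s + (3 * (- 1 / \<delta>) * k s ^ 2) *\<^sub>R h s) \<le> B"
            using 2 h'b norm_triangle_ineq[of "k s ^ 3 *\<^sub>R h' s" "(3 * (- 1 / \<delta>) * k s ^ 2) *\<^sub>R h s"]
            by (simp add: B_def)
          have sT: "s \<in> {0..T}" using s \<delta> t by auto
          show "norm (\<zeta> s) \<le> R"
            using norm_triangle_ineq[of "g s" "k s ^ 3 *\<^sub>R h s"] 1 Bg[OF sT]
            unfolding \<zeta>G G_def R_def by linarith
          show "norm (\<zeta>' s) \<le> R"
            using norm_triangle_ineq[of "g' s" "k s ^ 3 *\<^sub>R h' s + (3 * (- 1 / \<delta>) * k s ^ 2) *\<^sub>R h s"]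
              3 Bg'[OF sT] unfolding \<zeta>G G'_def R_def by linarith
        qed
        have "B \<ge> 0" by (simp add: B_def)
        have "w (t + \<delta>) \<le> v t + \<Lambda> * (t + \<delta> - t)"
        proof (rule solves_le[where a = t and b = "t + \<delta>" and w = w and W = "\<lambda>s. v t + \<Lambda> * (s - t)"
              and W' = "\<lambda>s. \<Lambda>" and g = \<zeta> and g' = \<zeta>'])
          fix s assume s: "s \<in> {t..t + \<delta>}"
          then show "(w has_real_derivative L (\<zeta> s, \<zeta>' s, w s)) (at s within {t..t + \<delta>})"
            using w(1) \<delta> t by (auto simp: solves_def intro: DERIV_subset[of _ _ _ "{0..T}"])
          show "((\<lambda>s. v t + \<Lambda> * (s - t)) has_real_derivative \<Lambda>) (at s within {t..t + \<delta>})"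
            by (auto intro!: derivative_eq_intros)
          have "0 \<le> \<Lambda> * (s - t)" using s \<open>\<Lambda> > 0\<close> by simp
          moreover have "\<Lambda> * (s - t) \<le> \<Lambda> * \<delta>" using s \<open>\<Lambda> > 0\<close> by (intro mult_left_mono) auto
          ultimately have "\<bar>v t + \<Lambda> * (s - t)\<bar> \<le> R"
            using \<delta>(4) \<open>B \<ge> 0\<close> unfolding R_def by linarith
          then have "(\<zeta> s, \<zeta>' s, v t + \<Lambda> * (s - t)) \<in> cball 0 R \<times> cball 0 R \<times> cball 0 R"
            using small[OF s] by simp
          with \<Lambda>0 have "\<bar>L (\<zeta> s, \<zeta>' s, v t + \<Lambda> * (s - t))\<bar> \<le> \<Lambda>0" by blast
          then show "L (\<zeta> s, \<zeta>' s, v t + \<Lambda> * (s - t)) \<le> \<Lambda>"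
            unfolding \<Lambda>_def by linarith
        qed (use \<delta> wt in auto)
        also have "\<dots> < w0 (t + \<delta>)"
        proof -
          have "dist (w0 (t + \<delta>)) (w0 t) < (w0 t - v t) / 2"
            by (rule \<sigma>) (use \<delta> t in \<open>auto simp: dist_real_def\<close>)
          then have "\<bar>w0 (t + \<delta>) - w0 t\<bar> < (w0 t - v t) / 2" by (simp add: dist_real_def)
          then have "w0 t - w0 (t + \<delta>) < (w0 t - v t) / 2" by linarith
          moreover have "\<Lambda> * (t + \<delta> - t) = \<Lambda> * \<delta>" by simp
          ultimately show ?thesis using \<delta>(5) by argo
        qed
        finally have less: "w (t + \<delta>) < w0 (t + \<delta>)" .
        \<comment> \<open>From here on both solutions follow the same curve, so the strict order
          persists up to \<open>T\<close>.\<close>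
        have after: "\<zeta> s = g s" "\<zeta>' s = g' s" if "s \<in> {t + \<delta>..T}" for s
          using that \<delta>(1) k_0[of s] by (auto simp: \<zeta>_def \<zeta>'_def G_def G'_def)
        have "w T < w0 T"
        proof (rule solves_less[where v = w and w = w0 and a = "t + \<delta>" and b = T and g = g and g' = g'])
          fix s assume s: "s \<in> {t + \<delta>..T}"
          have sub: "s \<in> {0..T}" "{t + \<delta>..T} \<subseteq> {0..T}" using s \<delta> t by auto
          have "(w has_real_derivative L (g s, g' s, w s)) (at s within {0..T})"
            using bspec[OF w(1)[unfolded solves_def] sub(1)] by (simp only: after[OF s])
          then show "(w has_real_derivative L (g s, g' s, w s)) (at s within {t + \<delta>..T})"
            by (rule DERIV_subset[OF _ sub(2)])
          show "(w0 has_real_derivative L (g s, g' s, w0 s)) (at s within {t + \<delta>..T})"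
            using w0(1) sub by (auto simp: solves_def intro: DERIV_subset[of _ _ _ "{0..T}"])
        qed (use less \<delta> in auto)
        moreover have "fund_sol L T (g 0) (g T) u \<le> w T - u"
        proof (rule fund_sol_le[OF \<zeta> _ w])
          show "\<zeta> 0 = g 0" using t f_eq(1)[of 0] f0 by (simp add: \<zeta>_def)
          show "\<zeta> T = g T" using after[of T] \<delta> by simp
        qed (use t in simp)
        ultimately show False using eq by simp
      qed
      then show "w0 t - u \<le> v t - u" by simp
    qed
  qed
qed (use eq in simp)

text \<open>By convexity the graph lies above its tangent at \<open>v\<close>, so the supremum is
  attained there.\<close>

lemma Ham_Legendre:
  assumes "strictly_convex (\<lambda>v. L (x, v, r))"
  shows "Ham L (x, Lv L (x, v, r), r) = Lv L (x, v, r) \<bullet> v - L (x, v, r)"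
proof -
  have "Lv L (x, v, r) \<bullet> w - L (x, w, r) \<le> Lv L (x, v, r) \<bullet> v - L (x, v, r)" for w
    using strictly_convex_above_tangent[OF assms has_derivative_L_v, of v w]
    by (simp add: L'_velocity inner_diff_right)
  then show ?thesis
    by (auto simp: Ham.simps intro!: cSup_eq_maximum)
qed

end

section \<open>Assembly of the four claims\<close>

lemma C2_imp_continuous_derivative:
  assumes "C2 f"
  obtains f' where "\<And>z. (f has_derivative blinfun_apply (f' z)) (at z)" "continuous_on UNIV f'"
proof -
  obtain f' f'' where f': "\<And>z. (f has_derivative blinfun_apply (f' z)) (at z)"
    and f'': "\<And>z. (f' has_derivative blinfun_apply (f'' z)) (at z)"
    using assms unfolding C2_def by blast
  have "continuous_on UNIV f'"
    by (rule has_derivative_continuous_on) (rule has_derivative_at_withinI[OF f''])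
  with f' show thesis by (rule that)
qed

theorem mainTheorem1:
  fixes L :: "(real ^ 'n) \<times> (real ^ 'n) \<times> real \<Rightarrow> real"
    and \<theta>\<^sub>0 \<theta>\<^sub>1 :: "real \<Rightarrow> real" and c\<^sub>0 c\<^sub>1 K t u :: real
    and x y :: "real ^ 'n" and \<xi> p :: "real \<Rightarrow> real ^ 'n" and u\<^sub>\<xi> :: "real \<Rightarrow> real"
  assumes L_C2: "C2 L"
    and L1: "\<And>x r. strictly_convex (\<lambda>v. L (x, v, r))"
    and L2: "superlinear \<theta>\<^sub>1" "superlinear \<theta>\<^sub>0" "0 \<le> c\<^sub>0" "0 \<le> c\<^sub>1"
      "\<And>x v. L (x, v, 0) \<le> \<theta>\<^sub>1 (norm v) + c\<^sub>1"
      "\<And>x v. \<theta>\<^sub>0 (norm v) - c\<^sub>0 \<le> L (x, v, 0)"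
    and L3: "0 < K" "\<And>x v r. \<bar>Lu L (x, v, r)\<bar> \<le> K"
    and H_C2: "C2 (Ham L)"
    and t: "0 < t"
    and min: "minimizer L t x y u \<xi>"
    and sol: "is_char_sol L t \<xi> u u\<^sub>\<xi>"
    and p: "\<And>s. s \<in> {0..t} \<Longrightarrow> p s = Lv L (\<xi> s, velocity t \<xi> s, u\<^sub>\<xi> s)"
  shows
    "((\<forall>s\<in>{0<..t}. Lv L (\<xi> s, velocity t \<xi> s, u\<^sub>\<xi> s) \<in> superdiff (\<lambda>z. fund_sol L s x z u) (\<xi> s)) \<and>
      ((\<lambda>z. fund_sol L t x z u) differentiable (at y) \<longrightarrow>
         grad (\<lambda>z. fund_sol L t x z u) y = Lv L (\<xi> t, velocity t \<xi> t, u\<^sub>\<xi> t))) \<and>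
     (- exp (int_Lu L t \<xi> u\<^sub>\<xi> t) *\<^sub>R Lv L (\<xi> 0, velocity t \<xi> 0, u\<^sub>\<xi> 0)
         \<in> superdiff (\<lambda>z. fund_sol L t z y u) x \<and>
      ((\<lambda>z. fund_sol L t z y u) differentiable (at x) \<longrightarrow>
         grad (\<lambda>z. fund_sol L t z y u) x
           = - exp (int_Lu L t \<xi> u\<^sub>\<xi> t) *\<^sub>R Lv L (\<xi> 0, velocity t \<xi> 0, u\<^sub>\<xi> 0))) \<and>
     (exp (int_Lu L t \<xi> u\<^sub>\<xi> t) - 1 \<in> superdiff (\<lambda>r. fund_sol L t x y r) u \<and>
      ((\<lambda>r. fund_sol L t x y r) differentiable (at u) \<longrightarrow>
         deriv (\<lambda>r. fund_sol L t x y r) u = exp (int_Lu L t \<xi> u\<^sub>\<xi> t) - 1)) \<and>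
     (- exp (int_Lu L t \<xi> u\<^sub>\<xi> t) * energy L t \<xi> u\<^sub>\<xi> t
         \<in> superdiff (\<lambda>\<tau>. fund_sol L \<tau> x y u) t \<and>
      ((\<lambda>\<tau>. fund_sol L \<tau> x y u) differentiable (at t) \<longrightarrow>
         deriv (\<lambda>\<tau>. fund_sol L \<tau> x y u) t
           = - exp (int_Lu L t \<xi> u\<^sub>\<xi> t) * energy L t \<xi> u\<^sub>\<xi> t \<and>
         - exp (int_Lu L t \<xi> u\<^sub>\<xi> t) * energy L t \<xi> u\<^sub>\<xi> t = - Ham L (\<xi> t, p t, u\<^sub>\<xi> t)))"
proof -
  obtain L' where L': "\<And>z. (L has_derivative blinfun_apply (L' z)) (at z)" "continuous_on UNIV L'"
    using C2_imp_continuous_derivative[OF L_C2] by blast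
  have "- c\<^sub>0 \<le> L (x, v, 0)" for x v
    using L2(6)[of v x] L2(2) by (auto simp: superlinear_def intro: order_trans[rotated])
  then interpret contact_lagrangian L L' K "c\<^sub>0"
    by unfold_locales (use L' L2 L3 in auto)

  have curve: "C2_curve t \<xi>" "\<xi> 0 = x" "\<xi> t = y" and opt: "action L t \<xi> u = fund_sol L t x y u"
    using min by (auto simp: minimizer_def curves_def)
  obtain \<xi>' \<xi>'' where \<xi>: "C2_on {0..t} \<xi> \<xi>' \<xi>''"
    using curve(1) by (auto simp: C2_curve_iff_C2_on)
  have vel: "velocity t \<xi> s = \<xi>' s" if "s \<in> {0..t}" for s
    by (rule velocity_eq[OF \<xi> t that])
  have sol': "solves t \<xi> \<xi>' u\<^sub>\<xi>" "u\<^sub>\<xi> 0 = u"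
    using sol is_char_sol_iff[OF \<xi> t] by auto
  have val: "fund_sol L t x y u = u\<^sub>\<xi> t - u"
    using action_eq[OF \<xi> t sol'] opt by simp
  obtain g g' g'' where g: "C2_on UNIV g g' g''"
    and g_eq: "\<And>s. s \<in> {0..t} \<Longrightarrow> g s = \<xi> s" "\<And>s. s \<in> {0..t} \<Longrightarrow> g' s = \<xi>' s"
    using C2_on_extend[OF \<xi>] t by (metis less_imp_le)
  have g01: "g 0 = x" "g t = y" using g_eq(1)[of 0] g_eq(1)[of t] t curve by auto
  \<comment> \<open>The solution along the prolonged curve agrees with \<open>u\<^sub>\<xi>\<close>
    on \<open>{0..t}\<close>. The unit of extra time serves every \<open>s \<le> t\<close> at once,
    as \<open>s + 1 \<le> t + 1\<close>.\<close>
  obtain w where w: "solves (t + 1) g g' w" "w 0 = u"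
    using solves_exists[of "t + 1" g g' u] C2_on_imp_continuous_on[OF C2_on_subset[OF g subset_UNIV]] t
    by (metis add_nonneg_nonneg less_imp_le zero_le_one)
  have w_eq: "w s = u\<^sub>\<xi> s" if "s \<in> {0..t}" for s
  proof (rule solves_unique[of t g g' w "u\<^sub>\<xi>"])
    show "solves t g g' w" by (rule solves_subset[OF w(1)]) simp
    show "solves t g g' u\<^sub>\<xi>" by (rule solves_cong[OF sol'(1)]) (simp add: g_eq)
  qed (use w sol' that in auto)
  define q where "q = (\<lambda>s. Lv L (g s, g' s, w s))"
  have q_eq: "Lv L (\<xi> s, velocity t \<xi> s, u\<^sub>\<xi> s) = q s" if "s \<in> {0..t}" for s
    using that by (simp add: q_def vel g_eq w_eq)

  \<comment> \<open>Optimality at intermediate times: otherwise the estimate at \<open>s\<close>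
    would start from a value possibly above \<open>fund_sol\<close>.\<close>
  have val_at: "fund_sol L s x (\<xi> s) u = u\<^sub>\<xi> s - u" if "s \<in> {0<..t}" for s
  proof -
    have "fund_sol L s (g 0) (g s) u = w s - u"
      by (rule fund_sol_restrict[OF g _ _ solves_subset[OF w(1)] w(2), of s t])
        (use that val g01 w_eq t in auto)
    then show ?thesis using that by (simp add: g01 g_eq w_eq)
  qed
  have y_sup: "supports_above (\<lambda>z. fund_sol L s x z u) (\<xi> s) (q s)" if s: "s \<in> {0<..t}" for s
    unfolding supports_above_def
  proof (intro allI impI)
    fix \<epsilon> :: real assume "\<epsilon> > 0"
    have "0 < s" "solves (s + 1) g g' w" using s solves_subset[OF w(1)] by auto
    from fund_sol_endpoint_bound[OF g this w(2) \<open>\<epsilon> > 0\<close>] obtain \<rho> where "0 < \<rho>"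
      and \<rho>: "\<And>\<tau> z. \<bar>\<tau> - s\<bar> < \<rho> \<Longrightarrow> norm (z - g s) < \<rho> \<Longrightarrow>
        fund_sol L \<tau> (g 0) z u \<le> w s - u + q s \<bullet> (z - g s) + (L (g s, g' s, w s) - q s \<bullet> g' s) * (\<tau> - s)
         + \<epsilon> * (norm (z - g s) + \<bar>\<tau> - s\<bar>)" unfolding q_def by metis
    have "fund_sol L s x z u \<le> fund_sol L s x (\<xi> s) u + q s \<bullet> (z - \<xi> s) + \<epsilon> * norm (z - \<xi> s)"
      if "norm (z - \<xi> s) < \<rho>" for z
      using \<rho>[of s z] s \<open>0 < \<rho>\<close> that by (simp add: g01 g_eq w_eq val_at)
    with \<open>0 < \<rho>\<close> show "\<exists>\<rho>>0. \<forall>z. norm (z - \<xi> s) < \<rho> \<longrightarrow> fund_sol L s x z u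
        \<le> fund_sol L s x (\<xi> s) u + q s \<bullet> (z - \<xi> s) + \<epsilon> * norm (z - \<xi> s)" by blast
  qed
  define l where "l = L (\<xi> t, velocity t \<xi> t, u\<^sub>\<xi> t) - q t \<bullet> velocity t \<xi> t"
  have t_sup: "supports_above (\<lambda>\<tau>. fund_sol L \<tau> x y u) t l"
    unfolding supports_above_def
  proof (intro allI impI)
    fix \<epsilon> :: real assume "\<epsilon> > 0"
    from fund_sol_endpoint_bound[OF g t w \<open>\<epsilon> > 0\<close>] obtain \<rho> where "0 < \<rho>"
      and \<rho>: "\<And>\<tau> z. \<bar>\<tau> - t\<bar> < \<rho> \<Longrightarrow> norm (z - g t) < \<rho> \<Longrightarrow>
        fund_sol L \<tau> (g 0) z u \<le> w t - u + q t \<bullet> (z - g t) + (L (g t, g' t, w t) - q t \<bullet> g' t) * (\<tau> - t)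
         + \<epsilon> * (norm (z - g t) + \<bar>\<tau> - t\<bar>)" unfolding q_def by metis
    have "fund_sol L \<tau> x y u \<le> fund_sol L t x y u + l \<bullet> (\<tau> - t) + \<epsilon> * norm (\<tau> - t)"
      if "norm (\<tau> - t) < \<rho>" for \<tau>
      using \<rho>[of \<tau> y] t \<open>0 < \<rho>\<close> that by (simp add: g01 g_eq w_eq vel val l_def curve)
    with \<open>0 < \<rho>\<close> show "\<exists>\<rho>>0. \<forall>\<tau>. norm (\<tau> - t) < \<rho> \<longrightarrow> fund_sol L \<tau> x y u
        \<le> fund_sol L t x y u + l \<bullet> (\<tau> - t) + \<epsilon> * norm (\<tau> - t)" by blast
  qed

  define J where "J = (\<lambda>s. exp (int_Lu L t \<xi> u\<^sub>\<xi> s))"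
  have J0: "J 0 = 1" by (simp add: J_def int_Lu_def)
  have "continuous_on {0..t} (\<lambda>s. Lu L (\<xi> s, \<xi>' s, u\<^sub>\<xi> s))"
    by (intro continuous_intros C2_on_imp_continuous_on[OF \<xi>] solves_continuous_on[OF sol'(1)])
  also have "?this \<longleftrightarrow> continuous_on {0..t} (\<lambda>s. Lu L (lift t \<xi> u\<^sub>\<xi> s))"
    by (intro continuous_on_cong) (auto simp: lift_def vel)
  finally have Luc: "continuous_on {0..t} (\<lambda>s. Lu L (lift t \<xi> u\<^sub>\<xi> s))" .
  have J: "(J has_real_derivative Lu L (\<xi> s, \<xi>' s, u\<^sub>\<xi> s) * J s) (at s within {0..t})" if s: "s \<in> {0..t}" for s
  proof -
    have "(int_Lu L t \<xi> u\<^sub>\<xi> has_real_derivative Lu L (\<xi> s, \<xi>' s, u\<^sub>\<xi> s)) (at s within {0..t})"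
      using integral_has_real_derivative[OF Luc s] s
      by (simp add: int_Lu_def[abs_def] lift_def vel)
    then show ?thesis unfolding J_def by (auto intro!: derivative_eq_intros)
  qed
  have val': "fund_sol L t (\<xi> 0) (\<xi> t) u = u\<^sub>\<xi> t - u" using val curve by simp
  have x_sup: "supports_above (\<lambda>z. fund_sol L t z y u) x (- J t *\<^sub>R q 0)"
    using fund_sol_start_supports[OF \<xi> t sol' J J0 val'] q_eq[of 0] vel[of 0] t curve by simp
  have u_sup: "supports_above (\<lambda>r. fund_sol L t x y r) u (J t - 1)"
    using fund_sol_initial_supports[OF \<xi> t sol' J J0 val'] curve by simp

  have Jt: "exp (int_Lu L t \<xi> u\<^sub>\<xi> t) = J t" by (simp add: J_def)
  \<comment> \<open>The exponential in front cancels the one inside \<open>energy\<close>, leaving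
    minus the Legendre expression.\<close>
  have l_eq: "- J t * energy L t \<xi> u\<^sub>\<xi> t = l"
    using q_eq[of t] t by (simp add: J_def energy_def l_def lift_def exp_minus flip: mult.assoc)
  have Ham: "l = - Ham L (\<xi> t, p t, u\<^sub>\<xi> t)"
    using Ham_Legendre[of "\<xi> t" "u\<^sub>\<xi> t" "velocity t \<xi> t", OF L1] q_eq[of t] p[of t] t by (simp add: l_def)

  show ?thesis
    unfolding Jt l_eq
    using t y_sup x_sup u_sup t_sup Ham curve(3)
    by (auto simp: q_eq
        intro: supports_above_imp_superdiff supports_above_imp_grad supports_above_imp_deriv)
qed

end
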